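(* Let $B(0,1) \subset \mathbb{C}$ be the open unit disc and let $D \subset B(0,1)$ be an arbitrary open set such that $0 \in \partial D$. Let $\Gamma = \partial D \cap B(0,1)$ and assume that $0$ is not an isolated point of $\Gamma$. Suppose that there is a continuous function $S : D \cup \Gamma \to \mathbb{C}$ that is holomorphic on $D$ and satisfies $S(z) = \overline{z}$ for all $z \in \Gamma$. Then \[ \lim_{z \in D,\ z \to 0} \left| \frac{S(z)}{z} \right| = 1. \]
   Context: $B(a,r)$ denotes the open disc in $\mathbb{C}$ with centre $a$ and radius $r$. The open set $D$ is not assumed to be connected. The boundary $\partial D$ is taken in $\mathbb{C}$. *)

theory Defs
  imports "HOL-Complex_Analysis.Complex_Analysis"
begin

end

theory Submission
  imports Defs
begin

text \<open>
  Let \<open>T = S\<close> on \<open>D\<close> and \<open>T = cnj\<close> off \<open>D\<close>; this is continuous near 0. For \<open>|u| \<noteq> 1\<close> the function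
  \<open>T z - u z\<close> is injective off \<open>D\<close>, so it omits there the values \<open>cnj z0 - u z0\<close> with \<open>z0\<close> in \<open>D\<close>, which
  can be chosen arbitrarily small. Such a value is attained only in \<open>D\<close>, where \<open>T\<close> is holomorphic,
  and its degree on a small circle bounds the number of preimages. Hence \<open>S z / z\<close> takes values
  \<open>u\<close> near a given \<open>w\<close> with \<open>|w| \<noteq> 1\<close> at most \<open>k\<close> times near 0.

  Suppose \<open>S z / z\<close> comes arbitrarily close to \<open>w\<close> as \<open>z\<close> tends to 0. Over the values \<open>u\<close> near \<open>w\<close>
  with a fibre of maximal size, the product of the fibre times its discriminant is holomorphic, and it
  tends to 0 at all other values, so by Rado's theorem it is holomorphic near \<open>w\<close> and its zeros are
  isolated. Thus a circle around \<open>w\<close> consists of values with maximal fibres. If points \<open>\<zeta>\<close> outside \<open>D\<close>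
  accumulated at 0, the maximum principle for the reciprocal of \<open>\<Prod>(a - \<zeta>)\<close>, taken over the fibre,
  would bound this product away from 0 near \<open>w\<close>, although a point of the fibre tends to 0. So 0 would
  be an isolated point of the boundary. The value infinity is treated by
  exchanging the roles of \<open>S z\<close> and \<open>z\<close>.
\<close>

subsection \<open>Rado's theorem\<close>

lemma Re_mult_cnj_poly_on_circle:
  fixes p q :: "complex poly"
  shows "\<exists>r. \<forall>z\<in>sphere 0 1. Re (poly p z * cnj (poly q z)) = Re (poly r z)"
proof (induction p arbitrary: q)
  case 0
  show ?case by (rule exI[of _ 0]) simp
next
  case (pCons a p)
  show ?case
  proof (cases q)
    case (pCons b q')
    obtain r where r: "\<And>z. z \<in> sphere 0 1 \<Longrightarrow> Re (poly p z * cnj (poly q' z)) = Re (poly r z)"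
      using pCons.IH by blast
    \<comment> \<open>As \<open>z * cnj z = 1\<close> on the circle, the product of the tails falls
      to the induction hypothesis, and \<open>a * cnj (z * poly q' z)\<close> may be replaced by its
      conjugate without changing the real part.\<close>
    define s where "s = [:a * cnj b:] + smult (cnj a) (pCons 0 q') + smult (cnj b) (pCons 0 p) + r"
    have "Re (poly (pCons a p) z * cnj (poly q z)) = Re (poly s z)" if z: "z \<in> sphere 0 1" for z
    proof -
      have zz: "z * cnj z = 1"
        using z by (simp add: complex_norm_square[symmetric])
      have "poly (pCons a p) z * cnj (poly q z)
          = a * cnj b + a * cnj (z * poly q' z) + cnj b * (z * poly p z)
            + (z * cnj z) * (poly p z * cnj (poly q' z))"
        by (simp add: pCons algebra_simps)
      then have "Re (poly (pCons a p) z * cnj (poly q z))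
          = Re (a * cnj b) + Re (a * cnj (z * poly q' z)) + Re (cnj b * (z * poly p z)) + Re (poly r z)"
        using r[OF z] by (simp only: zz mult_1 plus_complex.sel)
      moreover have "Re (a * cnj (z * poly q' z)) = Re (cnj a * (z * poly q' z))"
        by (simp add: algebra_simps)
      moreover have "poly s z = a * cnj b + cnj a * (z * poly q' z) + cnj b * (z * poly p z) + poly r z"
        by (simp add: s_def algebra_simps)
      ultimately show ?thesis by simp
    qed
    then show ?thesis by blast
  qed
qed

text \<open>Products are handled by \<open>Re x * Re y = Re (x * y + x * cnj y) / 2\<close> and the
  previous lemma. With Stone-Weierstrass this approximates continuous real functions on the circle
  by real parts of polynomials.\<close>

lemma real_polynomial_function_on_circle:
  fixes f :: "complex \<Rightarrow> real"
  assumes "real_polynomial_function f"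
  shows "\<exists>p. \<forall>z\<in>sphere 0 1. f z = Re (poly p z)"
  using assms
proof induction
  case (linear f)
  interpret f: bounded_linear f by fact
  have "f z = Re (poly [:0, Complex (f 1) (- f \<i>):] z)" for z
  proof -
    have "z = Re z *\<^sub>R 1 + Im z *\<^sub>R \<i>" by (simp add: complex_eq_iff)
    then have "f z = Re z * f 1 + Im z * f \<i>"
      by (metis f.add f.scaleR real_scaleR_def)
    then show ?thesis by simp
  qed
  then show ?case by blast
next
  case (const c)
  show ?case by (rule exI[of _ "[:of_real c:]"]) simp
next
  case (add f g)
  then obtain p q where "\<forall>z\<in>sphere 0 1. f z = Re (poly p z)" "\<forall>z\<in>sphere 0 1. g z = Re (poly q z)"
    by blast
  then show ?case by (intro exI[of _ "p + q"]) simp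
next
  case (mult f g)
  then obtain p q where pq: "\<forall>z\<in>sphere 0 1. f z = Re (poly p z)" "\<forall>z\<in>sphere 0 1. g z = Re (poly q z)"
    by blast
  obtain r where r: "\<forall>z\<in>sphere 0 1. Re (poly p z * cnj (poly q z)) = Re (poly r z)"
    using Re_mult_cnj_poly_on_circle by blast
  have "Re (poly p z) * Re (poly q z) = Re (poly (smult (1/2) (p * q + r)) z)"
    if "z \<in> sphere 0 1" for z
    using r that by (simp add: field_simps)
  with pq show ?case by (intro exI[of _ "smult (1/2) (p * q + r)"]) simp
qed

text \<open>The zeros of \<open>P\<close> are invisible to the maximum principle for \<open>g\<close>: apply it to \<open>g ^ n * P\<close>,
  which vanishes there, take \<open>n\<close>-th roots and let \<open>n\<close> tend to infinity.\<close>

lemma norm_le_off_zeros: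
  fixes P g :: "complex \<Rightarrow> complex"
  assumes contP: "continuous_on (cball 0 1) P" and holP: "P holomorphic_on {z \<in> ball 0 1. P z \<noteq> 0}"
    and contg: "continuous_on (cball 0 1) g" and holg: "g holomorphic_on {z \<in> ball 0 1. P z \<noteq> 0}"
    and C: "C > 0" "\<And>z. z \<in> sphere 0 1 \<Longrightarrow> norm (g z) \<le> C"
    and z: "z \<in> ball 0 1" "P z \<noteq> 0"
  shows "norm (g z) \<le> C"
proof (rule ccontr)
  assume "\<not> norm (g z) \<le> C"
  then have gt: "norm (g z) / C > 1" using C by simp
  define V where "V = {z \<in> ball 0 1. P z \<noteq> 0}"
  have V_sub: "closure V \<subseteq> cball 0 1"
    unfolding V_def by (metis (no_types, lifting) ball_subset_cball closed_cball closure_minimal mem_Collect_eq subset_eq)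
  have opV: "open V"
  proof -
    have "V = ball 0 1 \<inter> P -` (-{0})" by (auto simp: V_def)
    moreover have "continuous_on (ball 0 1) P"
      using contP ball_subset_cball continuous_on_subset by blast
    ultimately show ?thesis
      by (metis continuous_open_preimage open_ball open_Compl closed_singleton)
  qed
  have fr: "w \<in> sphere 0 1 \<or> P w = 0" "w \<in> cball 0 1" if "w \<in> frontier V" for w
    using that V_sub opV by (auto simp: frontier_def interior_open V_def)
  obtain M where M: "M > 0" "\<And>w. w \<in> cball 0 1 \<Longrightarrow> norm (P w) \<le> M"
    using compact_continuous_image[OF contP compact_cball]
    by (metis bounded_pos compact_imp_bounded imageI)
  have main: "norm (g z ^ n * P z) \<le> C ^ n * M" for n
  proof (rule maximum_modulus_frontier[where S = V and f = "\<lambda>z. g z ^ n * P z"])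
    show "(\<lambda>z. g z ^ n * P z) holomorphic_on interior V"
      using holP holg opV by (auto simp: interior_open V_def intro!: holomorphic_intros)
    show "continuous_on (closure V) (\<lambda>z. g z ^ n * P z)"
      using contP contg V_sub by (auto intro!: continuous_intros intro: continuous_on_subset)
    show "bounded V" unfolding V_def by (rule bounded_subset[OF bounded_ball[of 0 1]]) auto
    show "norm (g w ^ n * P w) \<le> C ^ n * M" if "w \<in> frontier V" for w
    proof (cases "P w = 0")
      case True
      then show ?thesis using C M by simp
    next
      case False
      then show ?thesis
        using fr[OF that] C M by (auto simp: norm_mult norm_power intro!: mult_mono power_mono)
    qed
    show "z \<in> V" using z by (simp add: V_def)
  qed
  obtain n where "M / norm (P z) < (norm (g z) / C) ^ n"
    using real_arch_pow[OF gt] by blast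
  then have "C ^ n * M < norm (g z) ^ n * norm (P z)"
    using C z by (simp add: field_simps)
  with main[of n] show False by (simp add: norm_mult norm_power)
qed

lemma Re_le_off_zeros:
  fixes P u :: "complex \<Rightarrow> complex"
  assumes contP: "continuous_on (cball 0 1) P" and holP: "P holomorphic_on {z \<in> ball 0 1. P z \<noteq> 0}"
    and contu: "continuous_on (cball 0 1) u" and holu: "u holomorphic_on {z \<in> ball 0 1. P z \<noteq> 0}"
    and c: "\<And>z. z \<in> sphere 0 1 \<Longrightarrow> Re (u z) \<le> c"
    and z: "z \<in> ball 0 1" "P z \<noteq> 0"
  shows "Re (u z) \<le> c"
proof -
  have "norm (exp (u z)) \<le> exp c"
    by (rule norm_le_off_zeros[where P = P and g = "\<lambda>z. exp (u z)"])
       (use assms in \<open>auto intro!: continuous_intros holomorphic_intros\<close>)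
  then show ?thesis by simp
qed

text \<open>Real parts of polynomials approximate \<open>Re u\<close> uniformly on the circle. The
  maximum principle off the zeros of \<open>P\<close>, applied to the difference with both signs,
  makes them converge to \<open>Re u\<close> wherever \<open>P z \<noteq> 0\<close>; a holomorphic
  limit is then extracted on the whole disc.\<close>

lemma Re_extension_off_zeros:
  fixes P u :: "complex \<Rightarrow> complex"
  assumes contP: "continuous_on (cball 0 1) P" and holP: "P holomorphic_on {z \<in> ball 0 1. P z \<noteq> 0}"
    and contu: "continuous_on (cball 0 1) u" and holu: "u holomorphic_on {z \<in> ball 0 1. P z \<noteq> 0}"
  obtains h where "h holomorphic_on ball 0 1"
    "\<And>z. z \<in> ball 0 1 \<Longrightarrow> P z \<noteq> 0 \<Longrightarrow> Re (h z) = Re (u z)"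
proof -
  have "\<exists>p. \<forall>z\<in>sphere 0 1. \<bar>Re (u z) - Re (poly p z)\<bar> < inverse (real (Suc n))" for n
  proof -
    have "continuous_on (sphere 0 1) (\<lambda>z. Re (u z))"
      using contu by (auto intro!: continuous_intros intro: continuous_on_subset)
    then obtain f where f: "real_polynomial_function f"
        "\<And>z. z \<in> sphere 0 1 \<Longrightarrow> \<bar>Re (u z) - f z\<bar> < inverse (real (Suc n))"
      using Stone_Weierstrass_real_polynomial_function[of "sphere (0::complex) 1" _ "inverse (real (Suc n))"]
      by (metis compact_sphere inverse_positive_iff_positive of_nat_0_less_iff zero_less_Suc)
    with real_polynomial_function_on_circle[OF f(1)] show ?thesis by force
  qed
  then obtain p where p: "\<And>n z. z \<in> sphere 0 1 \<Longrightarrow> \<bar>Re (u z) - Re (poly (p n) z)\<bar> < inverse (real (Suc n))"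
    by metis
  have lim: "(\<lambda>n. Re (poly (p n) z)) \<longlonglongrightarrow> Re (u z)" if z: "z \<in> ball 0 1" "P z \<noteq> 0" for z
  proof -
    have "\<bar>Re (poly (p n) z) - Re (u z)\<bar> \<le> inverse (real (Suc n))" for n
    proof -
      have b: "\<bar>Re (u w - poly (p n) w)\<bar> \<le> inverse (real (Suc n))" if "w \<in> sphere 0 1" for w
        using p[OF that, of n] by simp
      have "Re (u z - poly (p n) z) \<le> inverse (real (Suc n))"
        by (rule Re_le_off_zeros[OF contP holP _ _ _ z])
           (use b contu holu in \<open>auto intro!: continuous_intros holomorphic_intros simp: abs_le_iff\<close>)
      moreover have "Re (poly (p n) z - u z) \<le> inverse (real (Suc n))"
        by (rule Re_le_off_zeros[OF contP holP _ _ _ z])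
           (use b contu holu in \<open>auto intro!: continuous_intros holomorphic_intros simp: abs_le_iff\<close>)
      ultimately show ?thesis by simp
    qed
    then show ?thesis
      using LIMSEQ_inverse_real_of_nat Lim_null_comparison[of "\<lambda>n. Re (poly (p n) z) - Re (u z)"]
      by (subst LIM_zero_iff[symmetric]) (auto intro!: Lim_null_comparison[OF _ LIMSEQ_inverse_real_of_nat] always_eventually)
  qed
  obtain C where C: "\<And>z. z \<in> sphere 0 1 \<Longrightarrow> norm (u z) \<le> C"
  proof -
    have "continuous_on (sphere 0 1) u" using contu by (auto intro: continuous_on_subset)
    then have "bounded (u ` sphere 0 1)"
      by (simp add: compact_continuous_image compact_imp_bounded)
    then show ?thesis using that by (metis bounded_iff imageI)
  qed
  have Re_bd: "\<bar>Re (poly (p n) z)\<bar> \<le> C + 1" if z: "z \<in> ball 0 1" for n z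
  proof -
    have b: "\<bar>Re (poly (p n) w)\<bar> \<le> C + 1" if "w \<in> sphere 0 1" for w
    proof -
      have "inverse (real (Suc n)) \<le> 1" by (simp add: field_simps)
      moreover have "\<bar>Re (u w)\<bar> \<le> C" using C[OF that] abs_Re_le_cmod order_trans by blast
      ultimately show ?thesis using p[OF that, of n] by linarith
    qed
    have "Re (poly (p n) z) \<le> C + 1"
      by (rule maximum_real_frontier[where S = "cball 0 1"])
         (use b z in \<open>auto intro!: continuous_intros holomorphic_intros simp: abs_le_iff\<close>)
    moreover have "Re (- poly (p n) z) \<le> C + 1"
      by (rule maximum_real_frontier[where S = "cball 0 1"])
         (use b z in \<open>auto intro!: continuous_intros holomorphic_intros simp: abs_le_iff\<close>)
    ultimately show ?thesis by simp
  qed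
  \<comment> \<open>Only the real parts of the polynomials \<open>p n\<close> are bounded, while the
    imaginary parts may drift. Montel's theorem is therefore applied to their exponentials.\<close>
  define E where "E = (\<lambda>n z. exp (poly (p n) z))"
  obtain e r where e: "e holomorphic_on ball 0 1" and r: "strict_mono (r :: nat \<Rightarrow> nat)"
    and elim: "\<And>x. x \<in> ball 0 1 \<Longrightarrow> (\<lambda>n. E (r n) x) \<longlonglongrightarrow> e x"
  proof (rule Montel[of "ball 0 1" "range E" E])
    show "h holomorphic_on ball 0 1" if "h \<in> range E" for h
      using that by (auto simp: E_def intro!: holomorphic_intros)
    show "\<exists>B. \<forall>h\<in>range E. \<forall>z\<in>K. norm (h z) \<le> B" if "K \<subseteq> ball 0 1" for K
      using Re_bd that by (intro exI[of _ "exp (C + 1)"]) (force simp: E_def abs_le_iff)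
  qed auto
  \<comment> \<open>The lower bound on the real parts keeps the limit zero-free, so it has a
    holomorphic logarithm on the disc.\<close>
  have ne: "e z \<noteq> 0" if z: "z \<in> ball 0 1" for z
  proof -
    have "exp (- (C + 1)) \<le> norm (e z)"
    proof (rule Lim_bounded2[OF tendsto_norm[OF elim[OF z]], of 0])
      show "\<forall>n\<ge>0. exp (- (C + 1)) \<le> norm (E (r n) z)"
        using Re_bd[OF z] by (auto simp: E_def abs_le_iff) (metis add.commute minus_add_distrib neg_le_iff_le uminus_add_conv_diff diff_conv_add_uminus minus_le_iff)
    qed
    then show ?thesis by force
  qed
  obtain h where h: "h holomorphic_on ball 0 1" "\<And>z. z \<in> ball 0 1 \<Longrightarrow> e z = exp (h z)"
    using holomorphic_logarithm_exists[OF convex_ball open_ball e, of 0]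
    by (metis centre_in_ball ne zero_less_one)
  have "Re (h z) = Re (u z)" if z: "z \<in> ball 0 1" "P z \<noteq> 0" for z
  proof -
    have "(\<lambda>n. Re (poly (p (r n)) z)) \<longlonglongrightarrow> Re (u z)"
      using LIMSEQ_subseq_LIMSEQ[OF lim[OF z] r] by (simp add: o_def)
    then have "(\<lambda>n. norm (E (r n) z)) \<longlonglongrightarrow> exp (Re (u z))"
      unfolding E_def norm_exp_eq_Re by (rule tendsto_exp)
    with tendsto_norm[OF elim[OF z(1)]] have "norm (e z) = exp (Re (u z))"
      by (rule LIMSEQ_unique)
    then show ?thesis using h(2)[OF z(1)] by simp
  qed
  with h(1) show ?thesis using that by blast
qed

section \<open>Holomorphy across the zero set\<close>

lemma open_imp_fsigma:
  fixes S :: "'a::euclidean_space set"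
  assumes "open S"
  shows "fsigma S"
proof -
  obtain C :: "nat \<Rightarrow> 'a set" where "\<And>n. compact (C n)" "\<Union> (range C) = S"
    using open_Union_compact_subsets[OF assms] by metis
  then show ?thesis unfolding fsigma_Union_compact by (intro exI[of _ C]) auto
qed

text \<open>Extending \<open>Re P\<close> and \<open>Im P\<close> from \<open>V\<close> gives
  holomorphic \<open>h\<close> and \<open>k\<close> on the disc. On \<open>V\<close> they differ
  from \<open>P\<close> and \<open>- \<i> * P\<close> by locally constant functions, so
  \<open>k + \<i> * h\<close> is constant by analytic continuation, and \<open>G\<close>, which is
  \<open>h\<close> plus a constant, agrees with \<open>P\<close> on \<open>V\<close>. It remains to
  see that \<open>G\<close> also vanishes where \<open>P\<close> does.\<close>

theorem Rado_unit_disc: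
  fixes P :: "complex \<Rightarrow> complex"
  assumes contP: "continuous_on (cball 0 1) P" and holP: "P holomorphic_on {z \<in> ball 0 1. P z \<noteq> 0}"
  shows "P holomorphic_on ball 0 1"
proof (cases "\<exists>z\<in>ball 0 1. P z \<noteq> 0")
  case False
  then show ?thesis
    using holomorphic_cong[of "ball 0 1" "ball 0 1" P "\<lambda>z. 0"] by simp
next
  case True
  define V where "V = {z \<in> ball 0 1. P z \<noteq> 0}"
  have contP': "continuous_on (ball 0 1) P"
    using contP ball_subset_cball continuous_on_subset by blast
  have opV: "open V"
  proof -
    have "V = ball 0 1 \<inter> P -` (-{0})" by (auto simp: V_def)
    then show ?thesis
      by (metis contP' continuous_open_preimage open_ball open_Compl closed_singleton)
  qed
  obtain h where h: "h holomorphic_on ball 0 1" "\<And>z. z \<in> V \<Longrightarrow> Re (h z) = Re (P z)"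
    by (rule Re_extension_off_zeros[OF contP holP contP holP]) (simp add: V_def)
  obtain k where k: "k holomorphic_on ball 0 1" "\<And>z. z \<in> V \<Longrightarrow> Re (k z) = Re (- \<i> * P z)"
  proof (rule Re_extension_off_zeros[OF contP holP, of "\<lambda>z. - \<i> * P z"])
    show "continuous_on (cball 0 1) (\<lambda>z. - \<i> * P z)" using contP by (intro continuous_intros)
    show "(\<lambda>z. - \<i> * P z) holomorphic_on {z \<in> ball 0 1. P z \<noteq> 0}"
      using holP by (intro holomorphic_intros)
  qed (simp add: V_def)
  have V_ball: "V \<subseteq> ball 0 1" by (auto simp: V_def)
  \<comment> \<open>Otherwise the image of a small ball would be open, whereas it lies in the
    imaginary axis.\<close>
  have deriv_eq_0: "deriv f z = 0" if f: "f holomorphic_on V" "\<And>z. z \<in> V \<Longrightarrow> Re (f z) = 0" and z: "z \<in> V" for f z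
  proof (rule ccontr)
    assume "deriv f z \<noteq> 0"
    then obtain s where s: "s > 0" "ball z s \<subseteq> V" "inj_on f (ball z s)"
      using has_complex_derivative_locally_injective[OF f(1) z opV] by metis
    then have "open (f ` ball z s)"
      using open_mapping_thm3 f(1) holomorphic_on_subset open_ball by blast
    then obtain d where d: "d > 0" "ball (f z) d \<subseteq> f ` ball z s"
      using s(1) by (meson centre_in_ball image_eqI openE)
    then have "f z + of_real (d/2) \<in> f ` ball z s"
      by (auto simp: dist_norm subset_iff)
    then obtain y where "y \<in> ball z s" "f y = f z + of_real (d/2)" by force
    then have "Re (f z) + d/2 = 0"
      using f(2)[of y] s(2) by auto
    then show False using f(2)[OF z] d(1) by simp
  qed
  have "deriv k z = - \<i> * deriv h z" if z: "z \<in> V" for z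
  proof -
    have Pd: "P field_differentiable at z" "h field_differentiable at z" "k field_differentiable at z"
      using z opV V_ball holP h(1) k(1) unfolding V_def[symmetric]
      by (meson holomorphic_on_imp_differentiable_at holomorphic_on_subset)+
    have "deriv (\<lambda>z. P z - h z) z = 0"
      using h holP V_ball z
      by (intro deriv_eq_0) (auto intro!: holomorphic_intros intro: holomorphic_on_subset simp: V_def)
    moreover have "deriv (\<lambda>z. - \<i> * P z - k z) z = 0"
      using k holP V_ball z
      by (intro deriv_eq_0) (auto intro!: holomorphic_intros intro: holomorphic_on_subset simp: V_def)
    moreover have "deriv (\<lambda>z. - \<i> * P z - k z) z = - \<i> * deriv P z - deriv k z"
      using Pd unfolding DERIV_deriv_iff_field_differentiable[symmetric]
      by (intro DERIV_imp_deriv) (auto intro!: derivative_eq_intros)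
    ultimately show ?thesis
      using Pd by simp
  qed
  then have kh: "deriv (\<lambda>z. k z + \<i> * h z) z = 0" if z: "z \<in> V" for z
  proof -
    have "h field_differentiable at z" "k field_differentiable at z"
      using z V_ball h(1) k(1) by (meson holomorphic_on_imp_differentiable_at open_ball subsetD)+
    then show ?thesis
      using \<open>\<And>z. z \<in> V \<Longrightarrow> deriv k z = - \<i> * deriv h z\<close>[OF z] by (simp add: field_differentiable_mult)
  qed
  define d where "d = (\<lambda>z. k z + \<i> * h z)"
  have hold: "d holomorphic_on ball 0 1"
    using h k by (auto simp: d_def intro!: holomorphic_intros)
  obtain z0 where z0: "z0 \<in> V" using True by (auto simp: V_def)
  have "deriv d z = 0" if z: "z \<in> ball 0 1" for z
  proof (rule analytic_continuation_open[of V "ball 0 1" "deriv d" "\<lambda>_. 0"])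
    show "V \<noteq> {}" using z0 by auto
    show "deriv d holomorphic_on ball 0 1" by (simp add: hold holomorphic_deriv)
    show "deriv d z = 0" if "z \<in> V" for z using kh[OF that] by (simp add: d_def)
  qed (use opV z V_ball in auto)
  then have "\<exists>c. \<forall>z\<in>ball 0 1. d z = c"
    using has_field_derivative_0_imp_constant_on[of "ball 0 1" d] hold
    by (metis constant_on_def connected_ball holomorphic_derivI open_ball)
  then obtain c where c: "\<And>z. z \<in> ball 0 1 \<Longrightarrow> k z = c - \<i> * h z"
    unfolding d_def by (metis add_diff_cancel_right')
  define G where "G = (\<lambda>z. h z + \<i> * Re c)"
  have holG: "G holomorphic_on ball 0 1"
    using h(1) by (auto simp: G_def intro!: holomorphic_intros)
  have PG: "P z = G z" if z: "z \<in> V" for z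
  proof -
    have "Im (P z) = Re (c - \<i> * h z)"
      using k(2)[OF z] c[of z] z V_ball by auto
    then show ?thesis using h(2)[OF z] by (simp add: G_def complex_eq_iff)
  qed
  \<comment> \<open>The zeros of \<open>G\<close> are countable, so removing them leaves the disc
    connected; \<open>V\<close> is open and closed in the rest, hence all of it.\<close>
  define N where "N = {z \<in> ball 0 1. G z = 0}"
  have "countable N"
  proof (cases "G constant_on ball 0 1")
    case True
    then have "N = {}"
      using PG[OF z0] z0 by (auto simp: N_def V_def constant_on_def)
    then show ?thesis by simp
  next
    case False
    then show ?thesis
      unfolding N_def by (intro holomorphic_countable_zeros holG open_imp_fsigma) auto
  qed
  then have conn: "connected (ball 0 1 - N)"
    using path_connected_open_diff_countable[of "ball (0::complex) 1" N] path_connected_imp_connected by simp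
  have VN: "V = ball 0 1 - N"
  proof -
    have sub: "V \<subseteq> ball 0 1 - N" using PG by (auto simp: V_def N_def)
    have "openin (top_of_set (ball 0 1 - N)) V"
      using opV sub by (simp add: open_subset)
    moreover have "closedin (top_of_set (ball 0 1 - N)) V"
    proof -
      \<comment> \<open>Off \<open>N\<close> the equation \<open>P z = G z\<close> already forces
        \<open>P z \<noteq> 0\<close>, so \<open>V\<close> is a coincidence set and thus relatively
        closed.\<close>
      have "V = {z \<in> ball 0 1 - N. P z = G z}"
        using PG sub by (auto simp: V_def N_def)
      moreover have "continuous_on (ball 0 1 - N) P" "continuous_on (ball 0 1 - N) G"
        using contP' holG holomorphic_on_imp_continuous_on by (auto intro: continuous_on_subset)
      ultimately show ?thesis
        using continuous_closedin_preimage_constant[of "ball 0 1 - N" "\<lambda>z. P z - G z" 0]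
        by (simp add: continuous_on_diff)
    qed
    ultimately show ?thesis
      using conn z0 by (metis connected_clopen empty_iff)
  qed
  have "G z = P z" if z: "z \<in> ball 0 1" for z
  proof (cases "z \<in> V")
    case False
    have "z \<in> N" using z False unfolding VN by blast
    moreover have "P z = 0" using z False unfolding V_def by blast
    ultimately show ?thesis by (simp add: N_def)
  qed (simp add: PG)
  with holG show ?thesis by (rule holomorphic_transform)
qed

text \<open>Continuity is given only on the open disc, so smaller concentric closed discs are
  rescaled to the unit disc.\<close>

corollary Rado:
  fixes P :: "complex \<Rightarrow> complex"
  assumes contP: "continuous_on (ball a r) P" and holP: "P holomorphic_on {z \<in> ball a r. P z \<noteq> 0}"
  shows "P holomorphic_on ball a r"
proof -
  have *: "P holomorphic_on ball a s" if s: "0 < s" "s < r" for s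
  proof -
    define Q where "Q = P \<circ> (\<lambda>z. a + of_real s * z)"
    have img: "a + of_real s * z \<in> ball a r" if "z \<in> cball 0 1" for z
    proof -
      have "s * norm z \<le> s" using that s by (intro mult_left_le) auto
      with s have "s * norm z < r" by linarith
      then show ?thesis using s by (simp add: dist_norm norm_mult)
    qed
    have "Q holomorphic_on ball 0 1"
    proof (rule Rado_unit_disc)
      show "continuous_on (cball 0 1) Q"
        unfolding Q_def using img
        by (intro continuous_on_compose continuous_on_subset[OF contP] continuous_intros) auto
      show "Q holomorphic_on {z \<in> ball 0 1. Q z \<noteq> 0}"
        unfolding Q_def using img
        by (intro holomorphic_on_compose holomorphic_on_subset[OF holP] holomorphic_intros) (auto simp del: mem_ball)
    qed
    then have "Q \<circ> (\<lambda>z. (z - a) / of_real s) holomorphic_on ball a s"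
      using s by (intro holomorphic_on_compose holomorphic_intros)
        (auto elim!: holomorphic_on_subset simp: dist_norm norm_divide norm_minus_commute)
    moreover have "Q \<circ> (\<lambda>z. (z - a) / of_real s) = P"
      using s by (auto simp: Q_def)
    ultimately show ?thesis by simp
  qed
  have "P field_differentiable at z" if z: "z \<in> ball a r" for z
  proof -
    obtain s where "dist a z < s" "s < r" using z dense by (metis mem_ball)
    then show ?thesis
      using * [of s] by (metis holomorphic_on_imp_differentiable_at mem_ball open_ball order_le_less_trans zero_le_dist)
  qed
  then show ?thesis
    by (simp add: holomorphic_on_def field_differentiable_at_within)
qed

subsection \<open>Holomorphic maps with finite fibres\<close>

lemma open_image_of_finite_fibres:
  assumes "f holomorphic_on S" "open S" "\<And>y. finite {z \<in> S. f z = y}" "open U" "U \<subseteq> S"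
  shows "open (f ` U)"
proof (rule open_mapping_thm2[OF assms(1,2,4,5)])
  fix X assume X: "open X" "X \<subseteq> S" "X \<noteq> {}"
  show "\<not> f constant_on X"
  proof
    assume "f constant_on X"
    then obtain y where "\<And>z. z \<in> X \<Longrightarrow> f z = y" by (auto simp: constant_on_def)
    then have "X \<subseteq> {z \<in> S. f z = y}" using X by auto
    with assms(3) have "finite X" by (rule finite_subset[rotated])
    then show False
      using X finite_imp_not_open by blast
  qed
qed

lemma disjoint_balls_around_finite:
  fixes A :: "'a::metric_space set"
  assumes "finite A" "open W" "A \<subseteq> W"
  obtains e where "e > 0" "\<And>a. a \<in> A \<Longrightarrow> ball a e \<subseteq> W"
    "disjoint_family_on (\<lambda>a. ball a e) A"
proof -
  have "\<exists>e>0. \<forall>a\<in>A. ball a e \<subseteq> W"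
    using assms(1,3)
  proof (induction rule: finite_induct)
    case (insert a A)
    then obtain e where "e > 0" "\<forall>a\<in>A. ball a e \<subseteq> W" by auto
    moreover obtain d where "d > 0" "ball a d \<subseteq> W"
      using insert.prems assms(2) by (meson insert_subset openE)
    ultimately show ?case
      by (intro exI[of _ "min d e"]) (auto simp: subset_iff)
  qed (auto intro: exI[of _ 1])
  then obtain e where e: "e > 0" "\<And>a. a \<in> A \<Longrightarrow> ball a e \<subseteq> W" by blast
  have "\<exists>d>0. \<forall>a\<in>A. \<forall>b\<in>A. a \<noteq> b \<longrightarrow> d \<le> dist a b"
    using assms(1)
  proof (induction rule: finite_induct)
    case (insert x A)
    then obtain d where d: "d > 0" "\<forall>a\<in>A. \<forall>b\<in>A. a \<noteq> b \<longrightarrow> d \<le> dist a b" by auto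
    obtain d' where d': "d' > 0" "\<forall>b\<in>A. x \<noteq> b \<longrightarrow> d' \<le> dist x b"
      using finite_set_avoid[OF insert.hyps(1), of x] by (auto simp: dist_commute)
    show ?case
      using d d' by (intro exI[of _ "min d d'"]) (auto simp: min_le_iff_disj dist_commute)
  qed (auto intro: exI[of _ 1])
  then obtain d where d: "d > 0" "\<And>a b. a \<in> A \<Longrightarrow> b \<in> A \<Longrightarrow> a \<noteq> b \<Longrightarrow> d \<le> dist a b" by blast
  define m where "m = min e (d/2)"
  have "disjoint_family_on (\<lambda>a. ball a m) A"
    unfolding disjoint_family_on_def
  proof (intro ballI impI)
    fix a b assume ab: "a \<in> A" "b \<in> A" "a \<noteq> b"
    have "dist a b < d" if "dist a z < m" "dist b z < m" for z
      using dist_triangle[of a b z] that by (simp add: m_def dist_commute)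
    then show "ball a m \<inter> ball b m = {}" using d(2)[OF ab] by fastforce
  qed
  moreover have m: "m > 0" "m \<le> e" using e(1) d(1) by (auto simp: m_def)
  moreover have "ball a m \<subseteq> W" if "a \<in> A" for a
    using e(2)[OF that] subset_ball[OF m(2)] by blast
  ultimately show ?thesis by (intro that)
qed

text \<open>By the open mapping theorem every point of the fibre keeps a nearby preimage for all
  values close to \<open>y\<close>. Disjoint balls make these distinct, so the size of the fibre is
  lower semicontinuous.\<close>

lemma fibre_persists:
  assumes holf: "f holomorphic_on W" and W: "open W" and fin: "\<And>y. finite {z \<in> W. f z = y}"
  obtains e T where "0 < e" "open T" "y \<in> T"
    "\<And>a. a \<in> W \<Longrightarrow> f a = y \<Longrightarrow> ball a e \<subseteq> W"
    "disjoint_family_on (\<lambda>a. ball a e) {z \<in> W. f z = y}"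
    "\<And>a. a \<in> W \<Longrightarrow> f a = y \<Longrightarrow> T \<subseteq> f ` ball a e"
proof -
  let ?A = "{z \<in> W. f z = y}"
  obtain e where e: "e > 0" "\<And>a. a \<in> ?A \<Longrightarrow> ball a e \<subseteq> W"
      "disjoint_family_on (\<lambda>a. ball a e) ?A"
    using disjoint_balls_around_finite[OF fin W, of y] by blast
  define T where "T = (\<Inter>a\<in>?A. f ` ball a e)"
  have "open T"
    unfolding T_def using fin
    by (intro open_INT ballI open_image_of_finite_fibres[OF holf W fin] e) auto
  moreover have "y \<in> T" using e(1) by (force simp: T_def)
  ultimately show ?thesis
    using that[of e T] e by (auto simp: T_def)
qed

lemma card_fibre_lower:
  assumes fin: "\<And>y. finite {z \<in> W. f z = y}"
    and e: "\<And>a. a \<in> W \<Longrightarrow> f a = y \<Longrightarrow> ball a e \<subseteq> W"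
    and disj: "disjoint_family_on (\<lambda>a. ball a e) {z \<in> W. f z = y}"
    and T: "\<And>a. a \<in> W \<Longrightarrow> f a = y \<Longrightarrow> T \<subseteq> f ` ball a e"
    and v: "v \<in> T"
  obtains g where "inj_on g {z \<in> W. f z = y}" "\<And>a. a \<in> W \<Longrightarrow> f a = y \<Longrightarrow> g a \<in> ball a e"
    "g ` {z \<in> W. f z = y} \<subseteq> {z \<in> W. f z = v}"
proof -
  have "\<exists>g. \<forall>a\<in>{z \<in> W. f z = y}. g a \<in> ball a e \<and> f (g a) = v"
    using T v by (intro bchoice) fastforce
  then obtain g where g: "\<And>a. a \<in> W \<Longrightarrow> f a = y \<Longrightarrow> g a \<in> ball a e \<and> f (g a) = v" by auto
  have "inj_on g {z \<in> W. f z = y}"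
    using g disj by (intro inj_onI) (fastforce simp: disjoint_family_on_def)
  then show ?thesis using that g e by blast
qed

text \<open>Disjoint balls supply at least as many preimages of \<open>v\<close> as of
  \<open>y\<close>. Since the fibre over \<open>y\<close> has maximal size there are no others, so
  each ball contains exactly one and \<open>f\<close> has a holomorphic inverse branch
  there.\<close>

lemma fibre_local_branches:
  assumes holf: "f holomorphic_on W" and W: "open W" and fin: "\<And>y. finite {z \<in> W. f z = y}"
    and max: "\<And>v. card {z \<in> W. f z = v} \<le> card {z \<in> W. f z = y}"
  obtains T g where "open T" "y \<in> T"
    "\<And>a. a \<in> W \<Longrightarrow> f a = y \<Longrightarrow> g a holomorphic_on T"
    "\<And>v. v \<in> T \<Longrightarrow> bij_betw (\<lambda>a. g a v) {z \<in> W. f z = y} {z \<in> W. f z = v}"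
proof -
  let ?A = "{z \<in> W. f z = y}"
  obtain e T where T: "0 < e" "open T" "y \<in> T"
    "\<And>a. a \<in> W \<Longrightarrow> f a = y \<Longrightarrow> ball a e \<subseteq> W"
    "disjoint_family_on (\<lambda>a. ball a e) ?A"
    "\<And>a. a \<in> W \<Longrightarrow> f a = y \<Longrightarrow> T \<subseteq> f ` ball a e"
    by (rule fibre_persists[OF holf W fin]) blast
  have bij: "bij_betw h ?A {z \<in> W. f z = v}" 
    if v: "v \<in> T" and h: "\<And>a. a \<in> ?A \<Longrightarrow> h a \<in> ball a e \<and> f (h a) = v" for v h
  proof -
    have inj: "inj_on h ?A"
      using h T(5) by (intro inj_onI) (fastforce simp: disjoint_family_on_def)
    moreover have "h ` ?A = {z \<in> W. f z = v}"
    proof (rule card_seteq[OF fin])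
      show "h ` ?A \<subseteq> {z \<in> W. f z = v}" using h T(4) by blast
      show "card {z \<in> W. f z = v} \<le> card (h ` ?A)"
        using max[of v] card_image[OF inj] by simp
    qed
    ultimately show ?thesis by (simp add: bij_betw_def)
  qed
  \<comment> \<open>\<open>h\<close> enumerates the whole fibre over \<open>v\<close>, so a preimage
    in \<open>ball a e\<close> is some \<open>h b\<close>; it also lies in \<open>ball b e\<close>,
    and disjointness gives \<open>a = b\<close>.\<close>
  have uniq: "z = z'" if asm: "a \<in> ?A" "z \<in> ball a e" "z' \<in> ball a e" "f z = v" "f z' = v" "v \<in> T" for a z z' v
  proof -
    obtain h where h: "inj_on h ?A" "\<And>a. a \<in> W \<Longrightarrow> f a = y \<Longrightarrow> h a \<in> ball a e" "h ` ?A \<subseteq> {z \<in> W. f z = v}"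
    proof (rule card_fibre_lower[of W f y e T v])
      show "finite {z \<in> W. f z = u}" for u by (rule fin)
    qed (use T asm in auto)
    have *: "x = h a" if x: "x \<in> ball a e" "f x = v" for x
    proof -
      have "bij_betw h ?A {z \<in> W. f z = v}" using bij[OF \<open>v \<in> T\<close>] h by auto
      moreover have "x \<in> {z \<in> W. f z = v}" using x \<open>a \<in> ?A\<close> T(4) by blast
      ultimately obtain b where b: "b \<in> ?A" "x = h b" by (auto simp: bij_betw_def)
      then have "x \<in> ball b e" using h(2) by auto
      then have "a = b" using T(5) b(1) x \<open>a \<in> ?A\<close> unfolding disjoint_family_on_def by blast
      then show ?thesis using b by simp
    qed
    show ?thesis using *[of z] *[of z'] asm by simp
  qed
  have "\<exists>g. g holomorphic_on T \<and> (\<forall>v\<in>T. g v \<in> ball a e \<and> f (g v) = v)" if a: "a \<in> ?A" for a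
  proof -
    let ?S = "ball a e \<inter> f -` T"
    have sub: "ball a e \<subseteq> W" using a T(4) by auto
    then have hol: "f holomorphic_on ball a e" using holf holomorphic_on_subset by blast
    have opS: "open ?S"
      by (intro continuous_open_preimage holomorphic_on_imp_continuous_on hol T(2) open_ball)
    have holS: "f holomorphic_on ?S" using hol by (rule holomorphic_on_subset) auto
    have injS: "inj_on f ?S" using uniq[OF a] by (auto intro!: inj_onI)
    obtain g where g: "g holomorphic_on f ` ?S" "\<And>z. z \<in> ?S \<Longrightarrow> g (f z) = z"
    proof (rule holomorphic_has_inverse[OF holS opS injS])
      fix g assume "g holomorphic_on f ` ?S" "\<And>z. z \<in> ?S \<Longrightarrow> g (f z) = z"
      then show thesis by (rule that)
    qed
    have im: "\<exists>z\<in>?S. v = f z" if v: "v \<in> T" for v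
    proof -
      have "T \<subseteq> f ` ball a e" using a by (intro T(6)) auto
      then obtain z where "z \<in> ball a e" "v = f z" using v by blast
      then show ?thesis using v by blast
    qed
    then have "f ` ?S = T" by blast
    moreover have "g v \<in> ball a e \<and> f (g v) = v" if v: "v \<in> T" for v
    proof -
      obtain z where "z \<in> ?S" "v = f z" using im[OF v] by blast
      then show ?thesis using g(2) by auto
    qed
    ultimately show ?thesis using g(1) by auto
  qed
  then have "\<exists>g. \<forall>a\<in>?A. g a holomorphic_on T \<and> (\<forall>v\<in>T. g a v \<in> ball a e \<and> f (g a v) = v)"
    by (intro bchoice ballI)
  then obtain g where g: "\<And>a. a \<in> ?A \<Longrightarrow> g a holomorphic_on T"
      "\<And>a v. a \<in> ?A \<Longrightarrow> v \<in> T \<Longrightarrow> g a v \<in> ball a e \<and> f (g a v) = v"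
    by blast
  show ?thesis
  proof (rule that[of T g])
    show "bij_betw (\<lambda>a. g a v) ?A {z \<in> W. f z = v}" if "v \<in> T" for v
      using bij[OF that] g(2)[OF _ that] by simp
  qed (use T(2,3) g(1) in auto)
qed


section \<open>Symmetric functions of a maximal fibre\<close>

lemma holomorphic_on_locally:
  assumes "\<And>z. z \<in> V \<Longrightarrow> \<exists>T g. open T \<and> z \<in> T \<and> g holomorphic_on T \<and> (\<forall>u\<in>T. f u = g u)"
  shows "f holomorphic_on V"
proof -
  have "f field_differentiable at z" if z: "z \<in> V" for z
  proof -
    obtain T g where T: "open T" "z \<in> T" "g holomorphic_on T" "\<forall>u\<in>T. f u = g u"
      using assms[OF z] by blast
    then have "f holomorphic_on T"
      by (intro holomorphic_transform[OF T(3)]) simp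
    then show ?thesis using T holomorphic_on_imp_differentiable_at by blast
  qed
  then show ?thesis by (simp add: holomorphic_on_def field_differentiable_at_within)
qed

text \<open>Up to sign, the square of the Vandermonde product. Running over ordered pairs avoids
  choosing an order on the set; the diagonal factors are set to 1.\<close>

definition discriminant :: "'a::field set \<Rightarrow> 'a"
  where "discriminant A = (\<Prod>a\<in>A. \<Prod>b\<in>A. if a = b then 1 else a - b)"

lemma discriminant_nonzero: "finite A \<Longrightarrow> discriminant A \<noteq> 0"
  unfolding discriminant_def by simp

text \<open>A fibre of maximal size splits locally into holomorphic branches. Reindexing by the
  branches turns expressions symmetric in the points of the fibre into finite products of
  holomorphic functions.\<close>

lemma
  fixes f :: "complex \<Rightarrow> complex"
  assumes holf: "f holomorphic_on W" and W: "open W" and fin: "\<And>y. finite {z \<in> W. f z = y}"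
    and max: "\<And>v. card {z \<in> W. f z = v} \<le> M"
  shows open_maximal_fibres: "open {v. card {z \<in> W. f z = v} = M}" (is "open ?V")
    and holomorphic_prod_fibre: "c holomorphic_on W \<Longrightarrow>
      (\<lambda>v. \<Prod>a | a \<in> W \<and> f a = v. c a) holomorphic_on {v. card {z \<in> W. f z = v} = M}"
    and holomorphic_discriminant_fibre:
      "(\<lambda>v. discriminant {z \<in> W. f z = v}) holomorphic_on {v. card {z \<in> W. f z = v} = M}"
proof -
  have loc: "\<exists>T g. open T \<and> v0 \<in> T \<and> (\<forall>a\<in>{z \<in> W. f z = v0}. g a holomorphic_on T) \<and>
      (\<forall>v\<in>T. bij_betw (\<lambda>a. g a v) {z \<in> W. f z = v0} {z \<in> W. f z = v})" if v0: "v0 \<in> ?V" for v0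
  proof -
    have max': "card {z \<in> W. f z = v} \<le> card {z \<in> W. f z = v0}" for v
      using max v0 by simp
    show ?thesis
      by (rule fibre_local_branches[OF holf W fin max']) blast
  qed
  show "open ?V"
  proof (rule openI)
    fix v0 assume v0: "v0 \<in> ?V"
    then obtain T g where T: "open T" "v0 \<in> T"
        "\<And>v. v \<in> T \<Longrightarrow> bij_betw (\<lambda>a. g a v) {z \<in> W. f z = v0} {z \<in> W. f z = v}"
      using loc[OF v0] by blast
    have "T \<subseteq> ?V" using bij_betw_same_card[OF T(3)] v0 by auto
    then show "\<exists>e>0. ball v0 e \<subseteq> ?V" using T(1,2) by (meson openE order_trans)
  qed
  show "(\<lambda>v. \<Prod>a | a \<in> W \<and> f a = v. c a) holomorphic_on ?V" if c: "c holomorphic_on W"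
  proof (rule holomorphic_on_locally)
    fix v0 assume v0: "v0 \<in> ?V"
    let ?A = "{z \<in> W. f z = v0}"
    obtain T g where T: "open T" "v0 \<in> T" "\<And>a. a \<in> ?A \<Longrightarrow> g a holomorphic_on T"
        "\<And>v. v \<in> T \<Longrightarrow> bij_betw (\<lambda>a. g a v) ?A {z \<in> W. f z = v}"
      using loc[OF v0] by blast
    have "(\<Prod>a | a \<in> W \<and> f a = v. c a) = (\<Prod>a\<in>?A. c (g a v))" if "v \<in> T" for v
      using prod.reindex_bij_betw[OF T(4)[OF that], of c] by simp
    moreover have "(c \<circ> g a) holomorphic_on T" if "a \<in> ?A" for a
      using T(4) that by (intro holomorphic_on_compose_gen[OF T(3) c]) (auto simp: bij_betw_def)
    then have "(\<lambda>v. \<Prod>a\<in>?A. c (g a v)) holomorphic_on T"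
      by (intro holomorphic_on_prod) (simp add: o_def)
    ultimately show "\<exists>T g. open T \<and> v0 \<in> T \<and> g holomorphic_on T \<and>
        (\<forall>v\<in>T. (\<Prod>a | a \<in> W \<and> f a = v. c a) = g v)"
      using T(1,2) by (intro exI[of _ T] exI[of _ "\<lambda>v. \<Prod>a\<in>?A. c (g a v)"]) auto
  qed
  show "(\<lambda>v. discriminant {z \<in> W. f z = v}) holomorphic_on ?V"
  proof (rule holomorphic_on_locally)
    fix v0 assume v0: "v0 \<in> ?V"
    let ?A = "{z \<in> W. f z = v0}"
    obtain T g where T: "open T" "v0 \<in> T" "\<And>a. a \<in> ?A \<Longrightarrow> g a holomorphic_on T"
        "\<And>v. v \<in> T \<Longrightarrow> bij_betw (\<lambda>a. g a v) ?A {z \<in> W. f z = v}"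
      using loc[OF v0] by blast
    let ?G = "\<lambda>v. \<Prod>a\<in>?A. \<Prod>b\<in>?A. if a = b then 1 else g a v - g b v"
    have "discriminant {z \<in> W. f z = v} = ?G v" if v: "v \<in> T" for v
    proof -
      note bij = T(4)[OF v]
      have "discriminant {z \<in> W. f z = v}
          = (\<Prod>a\<in>?A. \<Prod>b\<in>?A. if g a v = g b v then 1 else g a v - g b v)"
        by (simp only: discriminant_def prod.reindex_bij_betw[OF bij, symmetric])
      also have "\<dots> = ?G v"
        using bij by (intro prod.cong refl) (auto simp: bij_betw_def inj_on_def)
      finally show ?thesis .
    qed
    moreover have "?G holomorphic_on T"
    proof (intro holomorphic_on_prod)
      fix a b assume "a \<in> ?A" "b \<in> ?A"
      then show "(\<lambda>v. if a = b then 1 else g a v - g b v) holomorphic_on T"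
        using T(3) by (cases "a = b") (auto intro!: holomorphic_intros)
    qed
    ultimately show "\<exists>T g. open T \<and> v0 \<in> T \<and> g holomorphic_on T \<and>
        (\<forall>v\<in>T. discriminant {z \<in> W. f z = v} = g v)"
      using T(1,2) by (intro exI[of _ T] exI[of _ ?G]) auto
  qed
qed

lemma norm_prod_le_small_factor:
  fixes x :: "'a \<Rightarrow> complex"
  assumes "finite I" "i \<in> I" "norm (x i) \<le> \<eta>" "C \<ge> 1" "\<And>j. j \<in> I \<Longrightarrow> norm (x j) \<le> C"
  shows "norm (prod x I) \<le> \<eta> * C ^ card I"
proof -
  have \<eta>: "\<eta> \<ge> 0" using assms(3) norm_ge_zero order_trans by blast
  have "norm (prod x I) = norm (x i) * (\<Prod>j\<in>I - {i}. norm (x j))"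
    using assms(1,2) by (simp add: prod.remove norm_mult prod_norm)
  also have "\<dots> \<le> \<eta> * (\<Prod>j\<in>I - {i}. C)"
    using assms \<eta> by (intro mult_mono prod_mono prod_nonneg) auto
  also have "\<dots> \<le> \<eta> * C ^ card I"
    using assms \<eta> by (intro mult_left_mono) (auto intro!: power_increasing)
  finally show ?thesis .
qed

lemma norm_prod_le_power:
  fixes x :: "'a \<Rightarrow> complex"
  assumes "\<And>j. j \<in> I \<Longrightarrow> norm (x j) \<le> C"
  shows "norm (prod x I) \<le> C ^ card I"
proof -
  have "norm (prod x I) \<le> (\<Prod>j\<in>I. C)"
    unfolding prod_norm[symmetric] using assms by (intro prod_mono) auto
  then show ?thesis by simp
qed

text \<open>By \<open>proper\<close>, points of a fibre can escape only into 0. So over values near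
  \<open>v\<close> each point is close to 0 or to the fibre over \<open>v\<close>. If none is near
  0, the pigeonhole principle puts two of them near the same point of that smaller fibre, hence near
  each other.\<close>

lemma fibre_near_deficient_value:
  assumes holf: "f holomorphic_on W" and W: "open W" and fin: "\<And>y. finite {z \<in> W. f z = y}"
    and proper: "\<And>K. compact K \<Longrightarrow> K \<subseteq> ball w \<delta> \<Longrightarrow> compact (insert 0 {z \<in> W. f z \<in> K})"
    and v: "v \<in> ball w \<delta>" "card {z \<in> W. f z = v} < M" and \<eta>: "\<eta> > 0"
  obtains T where "open T" "v \<in> T"
    "\<And>u. u \<in> T \<Longrightarrow> card {z \<in> W. f z = u} = M \<Longrightarrow>
       (\<exists>a\<in>{z \<in> W. f z = u}. norm a < \<eta>) \<or>
       (\<exists>a\<in>{z \<in> W. f z = u}. \<exists>b\<in>{z \<in> W. f z = u}. a \<noteq> b \<and> norm (a - b) < \<eta>)"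
proof -
  let ?F = "\<lambda>u. {z \<in> W. f z = u}"
  obtain d where d: "d > 0" "cball v d \<subseteq> ball w \<delta>"
    using v(1) open_contains_cball by (metis open_ball)
  \<comment> \<open>Deleting \<open>ball 0 \<eta>\<close> removes the adjoined point 0, so
    \<open>X\<close> inherits compactness from \<open>proper\<close>; its image is then closed and
    misses \<open>v\<close>.\<close>
  define X where "X = {z \<in> W. f z \<in> cball v d} - (\<Union>a\<in>?F v. ball a (\<eta>/2)) - ball 0 \<eta>"
  have "X = insert 0 {z \<in> W. f z \<in> cball v d} - ((\<Union>a\<in>?F v. ball a (\<eta>/2)) \<union> ball 0 \<eta>)"
    using \<eta> by (auto simp: X_def)
  then have "compact X"
    using compact_diff[OF proper[OF compact_cball d(2)]] by (simp add: open_UN open_Un)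
  moreover have "continuous_on X f"
    using holf by (rule continuous_on_subset[OF holomorphic_on_imp_continuous_on]) (auto simp: X_def)
  ultimately have "closed (f ` X)"
    by (simp add: compact_continuous_image compact_imp_closed)
  then have "open (ball v d - f ` X)" by (simp add: open_Diff)
  moreover have "v \<in> ball v d - f ` X"
    using d(1) \<eta> by (auto simp: X_def)
  moreover have "(\<exists>a\<in>?F u. norm a < \<eta>) \<or> (\<exists>a\<in>?F u. \<exists>b\<in>?F u. a \<noteq> b \<and> norm (a - b) < \<eta>)"
    if u: "u \<in> ball v d - f ` X" "card (?F u) = M" for u
  proof (cases "\<exists>a\<in>?F u. norm a < \<eta>")
    case False
    have "\<exists>b\<in>?F v. dist b a < \<eta>/2" if a: "a \<in> ?F u" for a
    proof -
      have "f a \<in> cball v d" using a u(1) by auto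
      moreover have "a \<notin> X" using a u(1) by auto
      moreover have "a \<notin> ball 0 \<eta>" using False a by auto
      ultimately show ?thesis using a by (auto simp: X_def)
    qed
    then obtain h where h: "\<And>a. a \<in> ?F u \<Longrightarrow> h a \<in> ?F v \<and> dist (h a) a < \<eta>/2"
      by metis
    have "\<not> inj_on h (?F u)"
    proof
      assume "inj_on h (?F u)"
      then have "card (?F u) \<le> card (?F v)"
        using h by (intro card_inj_on_le[OF _ _ fin]) auto
      then show False using u(2) v(2) by simp
    qed
    then obtain a b where ab: "a \<in> ?F u" "b \<in> ?F u" "a \<noteq> b" "h a = h b"
      by (auto simp: inj_on_def)
    have "dist a b < \<eta>"
      using dist_triangle_half_r[of "h a" a \<eta> b] h[OF ab(1)] h[OF ab(2)] ab(4) by simp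
    then show ?thesis using ab by (auto simp: dist_norm)
  qed simp
  ultimately show ?thesis by (rule that)
qed

lemma isolated_zero_at_point:
  assumes "P holomorphic_on ball w \<delta>" "v \<in> ball w \<delta>" "P v \<noteq> 0" "\<delta> > 0"
  obtains s where "0 < s" "s \<le> \<delta>" "\<And>u. u \<in> ball w s - {w} \<Longrightarrow> P u \<noteq> 0"
proof (cases "P w = 0")
  case True
  obtain s where "0 < s" "ball w s \<subseteq> ball w \<delta>" "\<And>u. u \<in> ball w s - {w} \<Longrightarrow> P u \<noteq> 0"
    by (rule isolated_zeros[where f = P and S = "ball w \<delta>" and \<xi> = w and \<beta> = v]) (use assms True in auto)
  then show ?thesis using that[of s] by (simp add: ball_subset_ball_iff)
next
  case False
  have "continuous_on (ball w \<delta>) P" using assms(1) holomorphic_on_imp_continuous_on by blast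
  then have "isCont P w"
    using assms(4) by (simp add: continuous_on_eq_continuous_at)
  then obtain s where "s > 0" "\<And>u. dist w u < s \<Longrightarrow> P u \<noteq> 0"
    using continuous_at_avoid[of w P 0] False by blast
  then show ?thesis using that[of "min s \<delta>"] assms(4) by simp
qed

text \<open>The hypothesis \<open>proper\<close> lets points of a fibre escape only into 0, and
  \<open>cluster\<close> says that 0 is approached over values tending to \<open>w\<close>. For
  fibres of bounded size this is incompatible with points \<open>\<zeta>\<close> off
  \<open>W\<close> accumulating at 0, because such a \<open>\<zeta>\<close> turns the product of
  \<open>a - \<zeta>\<close> over a fibre into a zero-free function.\<close>

theorem punctured_neighbourhood_of_finite_fibres:
  assumes holf: "f holomorphic_on W" and W: "open W" "bounded W" "0 \<notin> W"
    and img: "f ` W \<subseteq> ball w \<delta>"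
    and fin: "\<And>y. finite {z \<in> W. f z = y}" and bound: "\<And>y. card {z \<in> W. f z = y} \<le> k"
    and proper: "\<And>K. compact K \<Longrightarrow> K \<subseteq> ball w \<delta> \<Longrightarrow> compact (insert 0 {z \<in> W. f z \<in> K})"
    and cluster: "\<And>\<epsilon>. \<epsilon> > 0 \<Longrightarrow> \<exists>z\<in>W. norm z < \<epsilon> \<and> dist w (f z) < \<epsilon>"
  shows "\<exists>\<epsilon>>0. ball 0 \<epsilon> - {0} \<subseteq> W"
proof (rule ccontr)
  assume contra: "\<not> ?thesis"
  define F where "F = (\<lambda>u. {z \<in> W. f z = u})"
  have finF: "finite (F u)" for u using fin by (simp add: F_def)
  obtain M v1 where M: "card (F v1) = M" "\<And>u. card (F u) \<le> M"
  proof -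
    obtain v where "\<And>u. card (F u) \<le> card (F v)"
      using bound ex_has_greatest_nat[of "\<lambda>_. True" v1 "\<lambda>u. card (F u)" "Suc k"]
      by (auto simp: F_def less_Suc_eq_le)
    then show ?thesis using that by blast
  qed
  have max: "card {z \<in> W. f z = v} \<le> M" for v using M(2) by (simp add: F_def)
  obtain z0 where z0: "z0 \<in> W" using cluster[OF zero_less_one] by blast
  then have "F (f z0) \<noteq> {}" by (auto simp: F_def)
  then have "M \<noteq> 0" using M(2)[of "f z0"] finF by auto
  then have "F v1 \<noteq> {}" using M(1) by auto
  then have v1: "v1 \<in> ball w \<delta>" using img by (auto simp: F_def)
  then have \<delta>: "\<delta> > 0" by (meson dist_not_less_zero mem_ball not_less order_less_le_trans)
  obtain C where C: "C \<ge> 1" "\<And>a. a \<in> W \<Longrightarrow> norm a \<le> C" "\<And>a b. a \<in> W \<Longrightarrow> b \<in> W \<Longrightarrow> norm (a - b) \<le> C"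
    "\<And>a b. a \<in> W \<Longrightarrow> norm b \<le> 1 \<Longrightarrow> norm (a - b) \<le> C"
  proof -
    obtain B where B: "B > 0" "\<And>a. a \<in> W \<Longrightarrow> norm a \<le> B" using W(2) bounded_pos by metis
    show ?thesis
    proof (rule that[of "2 * B + 1"])
      fix a b
      assume "a \<in> W" "b \<in> W"
      then show "norm (a - b) \<le> 2 * B + 1"
        using B(1) B(2)[of a] B(2)[of b] norm_triangle_ineq4[of a b] by linarith
    next
      fix a b :: complex
      assume "a \<in> W" "norm b \<le> 1"
      then show "norm (a - b) \<le> 2 * B + 1"
        using B(1) B(2)[of a] norm_triangle_ineq4[of a b] by linarith
    next
      fix a
      assume "a \<in> W"
      then show "norm a \<le> 2 * B + 1" using B(1) B(2)[of a] by linarith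
    qed (use B(1) in simp)
  qed
  define V where "V = {v. card (F v) = M}"
  have opV: "open V"
    using open_maximal_fibres[OF holf W(1) fin max] by (simp add: V_def F_def)
  have hol_prod: "(\<lambda>v. \<Prod>a\<in>F v. c a) holomorphic_on V" if "c holomorphic_on W" for c
    using holomorphic_prod_fibre[OF holf W(1) fin max that] by (simp add: V_def F_def)
  \<comment> \<open>At the boundary of \<open>V\<close> two points of the fibre merge or one escapes to 0; the discriminant
    makes \<open>P\<close> vanish in the first case, the product of the fibre in the second.\<close>
  define P where "P = (\<lambda>v. if card (F v) = M then (\<Prod>a\<in>F v. a) * discriminant (F v) else 0)"
  have holP: "P holomorphic_on V"
  proof (rule holomorphic_transform)
    show "(\<lambda>v. (\<Prod>a\<in>F v. a) * discriminant (F v)) holomorphic_on V"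
      using hol_prod[of "\<lambda>a. a"] holomorphic_discriminant_fibre[OF holf W(1) fin max]
      by (intro holomorphic_on_mult) (simp_all add: V_def F_def)
  qed (simp add: P_def V_def)
  have P_nz: "P v \<noteq> 0 \<longleftrightarrow> v \<in> V" for v
  proof -
    have "(\<Prod>a\<in>F v. a) \<noteq> 0" using W(3) finF by (auto simp: F_def)
    then show ?thesis using discriminant_nonzero[OF finF] by (simp add: P_def V_def)
  qed
  \<comment> \<open>Accounts for all factors of \<open>P\<close>: \<open>M\<close> from the product
    of the fibre and \<open>M * M\<close> from the discriminant with its diagonal.\<close>
  define L where "L = C ^ (M + M * M)"
  have L: "L \<ge> 1" using C(1) by (simp add: L_def one_le_power)
  have disc_prod: "discriminant (F v) = (\<Prod>(a, b)\<in>F v \<times> F v. if a = b then 1 else a - b)" for v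
    unfolding discriminant_def by (simp add: prod.cartesian_product)
  have disc_le: "norm (discriminant (F v)) \<le> C ^ (M * M)" if "v \<in> V" for v
  proof -
    have "norm (discriminant (F v)) \<le> C ^ card (F v \<times> F v)"
      unfolding disc_prod using C(1,3) by (intro norm_prod_le_power) (auto simp: F_def)
    then show ?thesis using that by (simp add: card_cartesian_product V_def)
  qed
  have P_small1: "norm (P v) \<le> \<eta> * L" if v: "v \<in> V" and a: "a \<in> F v" "norm a \<le> \<eta>" for v a \<eta>
  proof -
    have "norm (\<Prod>a\<in>F v. a) \<le> \<eta> * C ^ card (F v)"
      using a C finF by (intro norm_prod_le_small_factor[of _ a]) (auto simp: F_def)
    then have "norm (\<Prod>a\<in>F v. a) * norm (discriminant (F v)) \<le> (\<eta> * C ^ M) * C ^ (M * M)"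
      using v disc_le[OF v] C(1) order_trans[OF norm_ge_zero a(2)] by (intro mult_mono) (auto simp: V_def)
    then show ?thesis using v by (simp add: P_def V_def L_def power_add norm_mult mult.assoc)
  qed
  have P_small2: "norm (P v) \<le> \<eta> * L"
    if v: "v \<in> V" and ab: "a \<in> F v" "b \<in> F v" "a \<noteq> b" "norm (a - b) \<le> \<eta>" for v a b \<eta>
  proof -
    have "norm (discriminant (F v)) \<le> \<eta> * C ^ card (F v \<times> F v)"
      unfolding disc_prod using ab C finF
      by (intro norm_prod_le_small_factor[of _ "(a, b)"]) (auto simp: F_def)
    moreover have "norm (\<Prod>a\<in>F v. a) \<le> C ^ card (F v)"
      using C by (intro norm_prod_le_power) (auto simp: F_def)
    ultimately have "norm (\<Prod>a\<in>F v. a) * norm (discriminant (F v)) \<le> C ^ M * (\<eta> * C ^ (M * M))"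
      using v C(1) order_trans[OF norm_ge_zero ab(4)]
      by (intro mult_mono) (auto simp: V_def card_cartesian_product)
    then show ?thesis using v by (simp add: P_def V_def L_def power_add norm_mult algebra_simps)
  qed
  have contP: "continuous_on (ball w \<delta>) P"
  proof (rule continuous_at_imp_continuous_on, rule ballI)
    fix v assume v: "v \<in> ball w \<delta>"
    show "isCont P v"
    proof (cases "v \<in> V")
      case True
      then show ?thesis
        using holP opV holomorphic_on_imp_continuous_on continuous_on_eq_continuous_at by blast
    next
      case False
      then have Pv: "P v = 0" and less: "card {z \<in> W. f z = v} < M"
        using M(2)[of v] by (auto simp: P_def V_def F_def)
      show ?thesis
        unfolding continuous_at Pv tendsto_iff
      proof (intro allI impI)
        fix e :: real assume e: "e > 0"
        have \<eta>: "e / (2 * L) > 0" using e L by simp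
        obtain T where T: "open T" "v \<in> T"
          "\<And>u. u \<in> T \<Longrightarrow> card {z \<in> W. f z = u} = M \<Longrightarrow>
             (\<exists>a\<in>{z \<in> W. f z = u}. norm a < e / (2 * L)) \<or>
             (\<exists>a\<in>{z \<in> W. f z = u}. \<exists>b\<in>{z \<in> W. f z = u}. a \<noteq> b \<and> norm (a - b) < e / (2 * L))"
          using fibre_near_deficient_value[OF holf W(1) fin proper v less \<eta>] by blast
        have "norm (P u) < e" if u: "u \<in> T" for u
        proof (cases "u \<in> V")
          case True
          then have "(\<exists>a\<in>F u. norm a < e / (2 * L)) \<or> (\<exists>a\<in>F u. \<exists>b\<in>F u. a \<noteq> b \<and> norm (a - b) < e / (2 * L))"
            using T(3)[OF u] by (simp add: V_def F_def)
          then have "norm (P u) \<le> e / (2 * L) * L"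
            using P_small1[OF True] P_small2[OF True] less_imp_le by blast
          then show ?thesis using e L by (simp add: field_simps)
        next
          case False
          then have "P u = 0" using P_nz by blast
          then show ?thesis using e by simp
        qed
        then show "\<forall>\<^sub>F u in at v. dist (P u) 0 < e"
          unfolding eventually_at_topological using T(1,2) by (intro exI[of _ T]) auto
      qed
    qed
  qed
  have "P holomorphic_on ball w \<delta>"
    by (rule Rado[OF contP], rule holomorphic_on_subset[OF holP]) (use P_nz in blast)
  moreover have "P v1 \<noteq> 0" using M(1) by (simp add: P_nz V_def)
  ultimately obtain s where s: "0 < s" "s \<le> \<delta>" "\<And>u. u \<in> ball w s - {w} \<Longrightarrow> P u \<noteq> 0"
    using isolated_zero_at_point[OF _ v1 _ \<delta>] by blast
  have sV: "ball w s - {w} \<subseteq> V" using s(3) P_nz by blast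
  define t where "t = s / 2"
  have t: "0 < t" "t < s" "cball w t \<subseteq> ball w \<delta>" "sphere w t \<subseteq> V"
    using s(1,2) sV by (auto simp: t_def)
  \<comment> \<open>\<open>P\<close> has no zero on the circle, so its modulus has a positive
    minimum there. By \<open>P_small1\<close>, a point too close to 0 in a fibre over the circle
    would push \<open>P\<close> below it.\<close>
  obtain \<eta> where \<eta>: "\<eta> > 0" "\<And>a. a \<in> W \<Longrightarrow> f a \<in> sphere w t \<Longrightarrow> \<eta> \<le> norm a"
  proof -
    have "compact (sphere w t)" "sphere w t \<noteq> {}" using t(1) by auto
    moreover have "continuous_on (sphere w t) (\<lambda>u. norm (P u))"
      using t(3) sphere_cball by (intro continuous_on_norm continuous_on_subset[OF contP]) blast
    ultimately obtain u0 where u0: "u0 \<in> sphere w t" "\<And>u. u \<in> sphere w t \<Longrightarrow> norm (P u0) \<le> norm (P u)"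
      using continuous_attains_inf[of "sphere w t" "\<lambda>u. norm (P u)"] by blast
    show ?thesis
    proof (rule that[of "norm (P u0) / L"])
      have "P u0 \<noteq> 0" using u0(1) t(4) P_nz by blast
      then show "norm (P u0) / L > 0" using L by simp
      fix a assume a: "a \<in> W" "f a \<in> sphere w t"
      then have "norm (P (f a)) \<le> norm a * L"
        using t(4) by (intro P_small1) (auto simp: F_def)
      then show "norm (P u0) / L \<le> norm a"
        using u0(2)[OF a(2)] L by (simp add: field_simps)
    qed
  qed
  \<comment> \<open>\<open>\<epsilon> \<le> 1\<close> lets \<open>C\<close> bound
    \<open>a - \<zeta>\<close>; \<open>\<epsilon> \<le> \<eta> / 2\<close> keeps the fibres over the
    circle at distance at least \<open>\<eta> / 2\<close> from \<open>\<zeta>\<close>; the last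
    bound makes the final estimate smaller than \<open>(\<eta> / 2) ^ M\<close>.\<close>
  define \<epsilon> where "\<epsilon> = min (min 1 (\<eta> / 2)) ((\<eta> / 2) ^ M / (4 * C ^ M))"
  have \<epsilon>: "\<epsilon> > 0" "\<epsilon> \<le> 1" "\<epsilon> \<le> \<eta> / 2" "\<epsilon> * C ^ M \<le> (\<eta> / 2) ^ M / 4"
  proof -
    show "\<epsilon> > 0" "\<epsilon> \<le> 1" "\<epsilon> \<le> \<eta> / 2" using \<eta>(1) C(1) by (auto simp: \<epsilon>_def)
    have "\<epsilon> \<le> (\<eta> / 2) ^ M / (4 * C ^ M)" by (simp add: \<epsilon>_def)
    then show "\<epsilon> * C ^ M \<le> (\<eta> / 2) ^ M / 4" using C(1) by (simp add: field_simps)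
  qed
  obtain \<zeta> where \<zeta>: "\<zeta> \<noteq> 0" "norm \<zeta> < \<epsilon>" "\<zeta> \<notin> W" using contra \<epsilon>(1) by force
  define Q where "Q = (\<lambda>v. \<Prod>a\<in>F v. a - \<zeta>)"
  have holQ: "Q holomorphic_on V"
    unfolding Q_def by (intro hol_prod holomorphic_intros)
  have Q_nz: "Q v \<noteq> 0" for v using \<zeta>(3) finF by (auto simp: Q_def F_def)
  have Q_lower: "c ^ M \<le> norm (Q v)" if "v \<in> V" "c \<ge> 0" "\<And>a. a \<in> F v \<Longrightarrow> c \<le> norm (a - \<zeta>)" for v c
  proof -
    have "(\<Prod>a\<in>F v. c) \<le> norm (Q v)"
      unfolding Q_def prod_norm[symmetric] using that by (intro prod_mono) auto
    then show ?thesis using that(1) by (simp add: V_def)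
  qed
  \<comment> \<open>\<open>\<zeta>\<close> lies off this compact set, so \<open>Q\<close> is bounded
    below on the punctured disc and its reciprocal has a removable singularity at \<open>w\<close>,
    the one value there whose fibre may be too small.\<close>
  define X where "X = insert 0 {z \<in> W. f z \<in> cball w t}"
  have "compact X" unfolding X_def by (rule proper[OF compact_cball t(3)])
  moreover have "\<zeta> \<notin> X" using \<zeta> by (simp add: X_def)
  ultimately obtain \<mu> where \<mu>: "\<mu> > 0" "\<And>x. x \<in> X \<Longrightarrow> \<mu> \<le> dist \<zeta> x"
    using separate_point_closed[of X \<zeta>] compact_imp_closed by blast
  have Q_\<mu>: "\<mu> ^ M \<le> norm (Q v)" if v: "v \<in> cball w t - {w}" for v
  proof (rule Q_lower)
    show "v \<in> V" using v t sV by auto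
    show "\<mu> \<le> norm (a - \<zeta>)" if "a \<in> F v" for a
      using \<mu>(2)[of a] that v by (auto simp: X_def F_def dist_norm norm_minus_commute)
  qed (use \<mu> in simp)
  have "\<exists>g. g holomorphic_on ball w s \<and> (\<forall>z\<in>ball w s - {w}. g z = inverse (Q z))"
  proof (subst holomorphic_on_extend_bounded)
    show "(\<lambda>z. inverse (Q z)) holomorphic_on ball w s - {w}"
      using holQ sV Q_nz by (intro holomorphic_intros holomorphic_on_subset[OF holQ]) auto
    show "\<exists>B. \<forall>\<^sub>F z in at w. norm (inverse (Q z)) \<le> B"
    proof (intro exI[of _ "inverse (\<mu> ^ M)"])
      show "\<forall>\<^sub>F z in at w. norm (inverse (Q z)) \<le> inverse (\<mu> ^ M)"
        unfolding eventually_at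
      proof (intro exI[of _ t] conjI ballI impI)
        fix z assume "z \<noteq> w \<and> dist z w < t"
        then show "norm (inverse (Q z)) \<le> inverse (\<mu> ^ M)"
          using Q_\<mu>[of z] \<mu>(1) by (simp add: norm_inverse dist_commute le_imp_inverse_le)
      qed (use t in simp)
    qed
  qed (use s in simp)
  then obtain g where g: "g holomorphic_on ball w s" "\<And>z. z \<in> ball w s - {w} \<Longrightarrow> g z = inverse (Q z)"
    by blast
  \<comment> \<open>The bound from \<open>\<mu>\<close> depends on \<open>\<zeta>\<close>. The
    maximum principle replaces it by one from the circle that depends only on \<open>\<eta>\<close>
    and \<open>M\<close>, which were fixed before \<open>\<zeta>\<close> was chosen.\<close>
  have g_le: "norm (g v) \<le> inverse ((\<eta> / 2) ^ M)" if v: "v \<in> cball w t" for v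
  proof (rule maximum_modulus_frontier[where S = "cball w t" and f = g])
    show "g holomorphic_on interior (cball w t)"
      using t(2) by (intro holomorphic_on_subset[OF g(1)]) auto
    show "continuous_on (closure (cball w t)) g"
      using t(2) by (intro holomorphic_on_imp_continuous_on holomorphic_on_subset[OF g(1)]) auto
    show "norm (g u) \<le> inverse ((\<eta> / 2) ^ M)" if "u \<in> frontier (cball w t)" for u
    proof -
      have u: "u \<in> sphere w t" using that by simp
      have "(\<eta> / 2) ^ M \<le> norm (Q u)"
      proof (rule Q_lower)
        show "u \<in> V" using u t(4) by auto
        fix a assume "a \<in> F u"
        then have "\<eta> \<le> norm a" using u by (intro \<eta>(2)) (auto simp: F_def)
        then show "\<eta> / 2 \<le> norm (a - \<zeta>)"
          using \<zeta>(2) \<epsilon>(3) norm_triangle_ineq2[of a \<zeta>] by linarith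
      qed (use \<eta> in simp)
      moreover have "g u = inverse (Q u)" using u t(1,2) by (intro g(2)) auto
      ultimately show ?thesis using \<eta>(1) by (simp add: norm_inverse le_imp_inverse_le)
    qed
  qed (use v in auto)
  \<comment> \<open>Serves to exclude \<open>f z = w\<close>, where \<open>g\<close> need not be the
    reciprocal of \<open>Q\<close>: a point closer to 0 than the fibre over \<open>w\<close> has
    another value.\<close>
  obtain \<rho> where \<rho>: "\<rho> > 0" "\<And>a. a \<in> F w \<Longrightarrow> \<rho> \<le> norm a"
  proof -
    obtain d where "d > 0" "\<forall>a\<in>F w. a \<noteq> 0 \<longrightarrow> d \<le> dist 0 a"
      using finite_set_avoid[OF finF, of w 0] by blast
    then show ?thesis using W(3) by (intro that[of d]) (auto simp: F_def)
  qed
  obtain z where z: "z \<in> W" "norm z < min (min \<rho> \<epsilon>) t" "dist w (f z) < min (min \<rho> \<epsilon>) t"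
    using cluster[of "min (min \<rho> \<epsilon>) t"] \<rho>(1) \<epsilon>(1) t(1) by auto
  have "f z \<noteq> w" using \<rho>(2)[of z] z by (auto simp: F_def)
  then have fz: "f z \<in> ball w s - {w}" using z(3) t(2) by auto
  have "norm (inverse (Q (f z))) \<le> inverse ((\<eta> / 2) ^ M)"
    using g_le[of "f z"] g(2)[OF fz] z(3) by simp
  then have "(\<eta> / 2) ^ M \<le> norm (Q (f z))"
    using \<eta>(1) Q_nz[of "f z"] by (simp add: norm_inverse)
  \<comment> \<open>\<open>z\<close> itself belongs to the fibre over \<open>f z\<close>, and its
    factor \<open>z - \<zeta>\<close> has norm at most \<open>2 * \<epsilon>\<close>.\<close>
  also have "\<dots> \<le> norm (z - \<zeta>) * C ^ card (F (f z))"
    unfolding Q_def using z(1) C \<zeta>(2) \<epsilon>(2) finF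
    by (intro norm_prod_le_small_factor[of _ z]) (auto simp: F_def)
  also have "\<dots> = norm (z - \<zeta>) * C ^ M" using fz sV by (auto simp: V_def)
  also have "\<dots> \<le> (2 * \<epsilon>) * C ^ M"
    using z(2) \<zeta>(2) norm_triangle_ineq4[of z \<zeta>] C(1) by (intro mult_right_mono) auto
  also have "\<dots> \<le> (\<eta> / 2) ^ M / 2" using \<epsilon>(4) by simp
  finally show False using \<eta>(1) by simp
qed

subsection \<open>Counting zeros by the degree on a circle\<close>

text \<open>The exponent is the winding number around 0. Along the circle \<open>F\<close> is a
  continuous logarithm of a constant, hence constant, and comparing its values at the two ends of
  the parameter interval gives \<open>k = l\<close>.\<close>

lemma power_exp_degree_unique:
  fixes g h :: "complex \<Rightarrow> complex"
  assumes r: "r > 0" and g: "continuous_on (sphere 0 r) g" and h: "continuous_on (sphere 0 r) h"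
    and eq: "\<And>z. z \<in> sphere 0 r \<Longrightarrow> z ^ k * exp (g z) = z ^ l * exp (h z)"
  shows "k = l"
proof -
  define c where "c = (\<lambda>t::real. of_real r * exp (\<i> * of_real t))"
  have c: "c t \<in> sphere 0 r" for t using r by (simp add: c_def norm_mult)
  define F where "F = (\<lambda>t::real. g (c t) - h (c t) + of_int (int k - int l) * (\<i> * of_real t))"
  have contc: "continuous_on {0..2*pi} c" unfolding c_def by (intro continuous_intros)
  have gc: "continuous_on {0..2*pi} (\<lambda>t. g (c t))" "continuous_on {0..2*pi} (\<lambda>t. h (c t))"
    using c continuous_on_compose2[OF g contc] continuous_on_compose2[OF h contc] by blast+
  have contF: "continuous_on {0..2*pi} F"
    unfolding F_def by (intro continuous_intros gc)
  have expF: "exp (F t) = of_real r ^ l / of_real r ^ k" for t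
  proof -
    have "of_real r ^ k * exp (of_nat k * (\<i> * of_real t)) * exp (g (c t))
        = of_real r ^ l * exp (of_nat l * (\<i> * of_real t)) * exp (h (c t))"
      using eq[OF c[of t]] by (simp add: c_def power_mult_distrib exp_of_nat_mult)
    then show ?thesis
      using r by (simp add: F_def exp_add exp_diff algebra_simps divide_simps)
  qed
  have "F constant_on {0..2*pi}"
  proof (rule continuous_discrete_range_constant[OF connected_Icc contF])
    fix t
    have "2 * pi \<le> norm (F s - F t)" if ne: "F s \<noteq> F t" for s
    proof -
      have "exp (F s) = exp (F t)" by (simp add: expF)
      then obtain n :: int where n: "F s = F t + of_int (2 * n) * pi * \<i>"
        by (auto simp: exp_eq)
      with ne have "n \<noteq> 0" by auto
      then have "1 \<le> \<bar>of_int n :: real\<bar>" by linarith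
      moreover have "norm (F s - F t) = 2 * \<bar>of_int n\<bar> * pi"
        by (simp add: n norm_mult)
      ultimately show ?thesis by simp
    qed
    then show "\<exists>e>0. \<forall>s. s \<in> {0..2*pi} \<and> F s \<noteq> F t \<longrightarrow> e \<le> norm (F s - F t)"
      by (intro exI[of _ "2 * pi"]) simp
  qed
  then have "F 0 = F (2 * pi)" by (auto simp: constant_on_def)
  moreover have "c 0 = c (2 * pi)"
  proof -
    have "c t = of_real r * cis t" for t by (simp add: c_def cis_conv_exp)
    then show ?thesis by simp
  qed
  ultimately have "of_int (int k - int l) * (\<i> * of_real (2 * pi)) = 0"
    by (simp add: F_def)
  then show "k = l" by simp
qed

text \<open>\<open>H\<close> is only continuous off \<open>D\<close>, so the factor is split off by
  the local factorisation at \<open>a\<close> and the quotient is glued with it. Finiteness of the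
  zero set excludes that \<open>H\<close> vanishes identically near \<open>a\<close>.\<close>

lemma divide_out_zero:
  fixes H :: "complex \<Rightarrow> complex"
  assumes D: "open D" "D \<subseteq> X" and contH: "continuous_on X H" and holH: "H holomorphic_on D"
    and a: "a \<in> D" "H a = 0" and fin: "finite {z \<in> X. H z = 0}"
  obtains n H1 where "n > 0" "continuous_on X H1" "H1 holomorphic_on D"
    "\<And>z. z \<in> X \<Longrightarrow> H z = (z - a) ^ n * H1 z" "{z \<in> X. H1 z = 0} = {z \<in> X. H z = 0} - {a}"
proof -
  obtain \<rho>0 where \<rho>0: "\<rho>0 > 0" "ball a \<rho>0 \<subseteq> D" using D(1) a(1) openE by blast
  have "\<not> H constant_on ball a \<rho>0"
  proof
    assume "H constant_on ball a \<rho>0"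
    then have "\<forall>z\<in>ball a \<rho>0. H z = 0"
      using a(2) \<rho>0(1) unfolding constant_on_def by (metis centre_in_ball)
    then have "ball a \<rho>0 \<subseteq> {z \<in> X. H z = 0}" using \<rho>0(2) D(2) by blast
    then have "finite (ball a \<rho>0)" using fin finite_subset by blast
    then show False using \<rho>0(1) finite_imp_not_open[of "ball a \<rho>0"] by simp
  qed
  then obtain g \<rho> n where n: "0 < n" and \<rho>: "0 < \<rho>" "ball a \<rho> \<subseteq> ball a \<rho>0" and g: "g holomorphic_on ball a \<rho>"
      "\<And>w. w \<in> ball a \<rho> \<Longrightarrow> H w = (w - a) ^ n * g w" "\<And>w. w \<in> ball a \<rho> \<Longrightarrow> g w \<noteq> 0"
    using \<rho>0 a holH
    by (elim holomorphic_factor_zero_nonconstant[of H "ball a \<rho>0" a, rotated 5])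
       (auto intro: holomorphic_on_subset)
  define H1 where "H1 = (\<lambda>z. if z = a then g a else H z / (z - a) ^ n)"
  have H1g: "H1 z = g z" if "z \<in> ball a \<rho>" for z
    using g(2)[OF that] by (auto simp: H1_def)
  have sub: "ball a \<rho> \<subseteq> D" using \<rho>(2) \<rho>0(2) by blast
  have H1_hol_ball: "H1 holomorphic_on ball a \<rho>"
    using g(1) by (rule holomorphic_transform) (simp only: H1g)
  have "(\<lambda>z. H z / (z - a) ^ n) holomorphic_on D - {a}"
    by (intro holomorphic_intros holomorphic_on_subset[OF holH]) auto
  then have "H1 holomorphic_on D - {a}"
    by (rule holomorphic_transform) (auto simp: H1_def)
  then have "H1 holomorphic_on (D - {a}) \<union> ball a \<rho>"
    using H1_hol_ball D(1) by (intro holomorphic_on_Un) auto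
  moreover have "(D - {a}) \<union> ball a \<rho> = D" using sub \<rho>(1) by auto
  ultimately have holH1: "H1 holomorphic_on D" by simp
  have "continuous_on (X - {a}) (\<lambda>z. H z / (z - a) ^ n)"
    by (intro continuous_intros continuous_on_subset[OF contH]) auto
  then have "continuous_on (X - {a}) H1"
    by (rule continuous_on_eq) (auto simp: H1_def)
  have "continuous_on (ball a \<rho>) H1"
    using H1_hol_ball holomorphic_on_imp_continuous_on by blast
  have X_eq: "(X - {a}) \<union> ball a \<rho> = X" using sub D(2) \<rho>(1) by auto
  have "continuous_on ((X - {a}) \<union> ball a \<rho>) H1"
  proof (rule continuous_on_Un_local_open)
    show "openin (top_of_set (X - {a} \<union> ball a \<rho>)) (X - {a})"
      unfolding X_eq by (metis Diff_eq openin_open open_Compl closed_singleton)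
    show "openin (top_of_set (X - {a} \<union> ball a \<rho>)) (ball a \<rho>)"
      unfolding X_eq using sub D(2) by (intro open_subset) auto
  qed fact+
  then have contH1: "continuous_on X H1" by (simp only: X_eq)
  have "H z = (z - a) ^ n * H1 z" for z
    using n a(2) by (auto simp: H1_def)
  moreover have "H1 a \<noteq> 0" using H1g[of a] g(3)[of a] \<rho>(1) by simp
  then have "{z \<in> X. H1 z = 0} = {z \<in> X. H z = 0} - {a}"
    by (auto simp: H1_def)
  ultimately show ?thesis using that[OF n contH1 holH1] by simp
qed

text \<open>Induction on the number of zeros: a zero-free continuous function on the closed disc has
  a logarithm, and splitting off a zero of order \<open>n\<close> contributes \<open>n\<close> to
  the exponent. The cardinality ignores multiplicities, hence the inequality.\<close>

lemma degree_ge_card_zeros: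
  fixes H :: "complex \<Rightarrow> complex"
  assumes D: "open D" "D \<subseteq> ball 0 r" and r: "r > 0"
    and "continuous_on (cball 0 r) H" "H holomorphic_on D"
    and "\<And>z. z \<in> cball 0 r \<Longrightarrow> H z = 0 \<Longrightarrow> z \<in> D"
    and "finite {z \<in> cball 0 r. H z = 0}"
  shows "\<exists>k g. card {z \<in> cball 0 r. H z = 0} \<le> k \<and> continuous_on (sphere 0 r) g \<and>
           (\<forall>z\<in>sphere 0 r. H z = z ^ k * exp (g z))"
  using assms(4-)
proof (induction "card {z \<in> cball 0 r. H z = 0}" arbitrary: H)
  case 0
  then have nz: "H z \<noteq> 0" if "z \<in> cball 0 r" for z using that by auto
  obtain g where "continuous_on (cball 0 r) g" "\<And>z. z \<in> cball 0 r \<Longrightarrow> H z = exp (g z)"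
    using continuous_logarithm_on_cball[OF "0.prems"(1) nz] by blast
  then show ?case
    using "0.hyps" by (intro exI[of _ 0] exI[of _ g]) (auto intro: continuous_on_subset)
next
  case (Suc m)
  then obtain a where a: "a \<in> cball 0 r" "H a = 0"
    by (metis (mono_tags, lifting) Collect_empty_eq card.empty nat.simps(3))
  have aD: "a \<in> D" using Suc.prems(3) a by blast
  have DX: "D \<subseteq> cball 0 r" using D(2) ball_subset_cball by blast
  obtain n H1 where n: "n > 0" and H1: "continuous_on (cball 0 r) H1" "H1 holomorphic_on D"
    "\<And>z. z \<in> cball 0 r \<Longrightarrow> H z = (z - a) ^ n * H1 z"
    "{z \<in> cball 0 r. H1 z = 0} = {z \<in> cball 0 r. H z = 0} - {a}"
    using divide_out_zero[OF D(1) DX Suc.prems(1,2) aD a(2) Suc.prems(4)] by blast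
  have card: "card {z \<in> cball 0 r. H1 z = 0} = m"
    unfolding H1(4) using Suc.hyps(2) a by (simp add: card_Diff_singleton_if)
  have "\<exists>k g. card {z \<in> cball 0 r. H1 z = 0} \<le> k \<and> continuous_on (sphere 0 r) g \<and>
           (\<forall>z\<in>sphere 0 r. H1 z = z ^ k * exp (g z))"
  proof (rule Suc.hyps(1))
    show "z \<in> D" if "z \<in> cball 0 r" "H1 z = 0" for z
      using that H1(3)[OF that(1)] Suc.prems(3) n by simp
    show "finite {z \<in> cball 0 r. H1 z = 0}" unfolding H1(4) using Suc.prems(4) by simp
  qed (use card H1(1,2) in simp_all)
  then obtain k g where k: "m \<le> k" and g: "continuous_on (sphere 0 r) g"
      "\<And>z. z \<in> sphere 0 r \<Longrightarrow> H1 z = z ^ k * exp (g z)"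
    using card by auto
  \<comment> \<open>As \<open>a\<close> lies inside the circle, \<open>1 - a / z\<close> stays in
    the right half-plane, so \<open>(z - a) ^ n\<close> is \<open>z ^ n\<close> times the
    exponential of a continuous function.\<close>
  have Re_pos: "Re (1 - a / z) > 0" if z: "z \<in> sphere 0 r" for z
  proof -
    have "norm (a / z) < 1" using z aD D(2) r by (auto simp: norm_divide)
    then have "Re (a / z) < 1" using complex_Re_le_cmod order_le_less_trans by blast
    then show ?thesis by simp
  qed
  define G where "G = (\<lambda>z. of_nat n * Ln (1 - a / z) + g z)"
  have "continuous_on (sphere 0 r) (\<lambda>z. Ln (1 - a / z))"
  proof (intro continuous_intros)
    show "1 - a / z \<notin> \<real>\<^sub>\<le>\<^sub>0" if "z \<in> sphere 0 r" for z
      using Re_pos[OF that] by (auto simp: complex_nonpos_Reals_iff)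
  qed (use r in auto)
  then have "continuous_on (sphere 0 r) G"
    unfolding G_def by (intro continuous_on_add continuous_on_mult continuous_on_const g(1))
  moreover have "H z = z ^ (n + k) * exp (G z)" if z: "z \<in> sphere 0 r" for z
  proof -
    have z0: "z \<noteq> 0" using z r by auto
    have nz: "1 - a / z \<noteq> 0" using Re_pos[OF z] by auto
    have "H z = (z - a) ^ n * (z ^ k * exp (g z))" using H1(3)[of z] g(2)[OF z] z by simp
    also have "(z - a) ^ n = z ^ n * exp (of_nat n * Ln (1 - a / z))"
    proof -
      have "z - a = z * (1 - a / z)" using z0 by (simp add: field_simps)
      then have "(z - a) ^ n = z ^ n * (1 - a / z) ^ n" by (metis power_mult_distrib)
      then show ?thesis using nz by (simp add: exp_of_nat_mult)
    qed
    finally show ?thesis by (simp add: G_def exp_add power_add)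
  qed
  moreover have "Suc m \<le> n + k" using n k by simp
  ultimately show ?case using Suc.hyps(2) by metis
qed

text \<open>As \<open>D\<close> may be disconnected, the identity theorem alone does not exclude
  components on which \<open>H\<close> vanishes. Instead, the interior of the zero set is open and
  closed in the connected set \<open>\<Omega> - F\<close>, so it is empty unless
  \<open>\<Omega> - F\<close> lies in \<open>D\<close>.\<close>

lemma isolated_zeros_of_closed_zero_set:
  fixes H :: "complex \<Rightarrow> complex"
  assumes \<Omega>: "open \<Omega>" "connected \<Omega>" and D: "open D" "D \<subseteq> \<Omega>" and holH: "H holomorphic_on D"
    and F: "finite F" "F \<inter> D = {}" and nsub: "\<not> \<Omega> - F \<subseteq> D"
    and clo: "closedin (top_of_set \<Omega>) ({z \<in> D. H z = 0} \<union> F)"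
    and a: "a \<in> D"
  shows "\<exists>\<rho>>0. ball a \<rho> \<subseteq> D \<and> (\<forall>z\<in>ball a \<rho> - {a}. H z \<noteq> 0)"
proof -
  define Z where "Z = {z \<in> D. H z = 0}"
  have dich: "(\<forall>z\<in>ball x \<rho>. H z = 0) \<or> (\<exists>d>0. d \<le> \<rho> \<and> (\<forall>z\<in>ball x d - {x}. H z \<noteq> 0))"
    if x: "ball x \<rho> \<subseteq> D" "\<rho> > 0" for x \<rho>
  proof (cases "\<forall>z\<in>ball x \<rho>. H z = 0")
    case False
    then obtain b where "b \<in> ball x \<rho>" "H b \<noteq> 0" by blast
    then show ?thesis
      using isolated_zero_at_point[of H x \<rho> b] x holomorphic_on_subset[OF holH x(1)] by metis
  qed simp
  have "interior Z = {}"
  proof (rule ccontr)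
    assume ne: "interior Z \<noteq> {}"
    have sub: "interior Z \<subseteq> \<Omega> - F"
      using interior_subset[of Z] D(2) F(2) by (auto simp: Z_def)
    \<comment> \<open>A limit \<open>x\<close> of interior points lies in \<open>D\<close>, since
      the zero set together with \<open>F\<close> is closed in \<open>\<Omega>\<close>. Zeros
      accumulate at \<open>x\<close>, so \<open>H\<close> vanishes on a ball around it.\<close>
    have "closedin (top_of_set (\<Omega> - F)) (interior Z)"
      unfolding closedin_limpt
    proof (intro conjI sub allI impI)
      fix x assume x: "x islimpt interior Z \<and> x \<in> \<Omega> - F"
      then have "x islimpt (Z \<union> F)"
        by (meson interior_subset islimpt_subset order_trans sup_ge1)
      then have "x \<in> Z \<union> F" using clo x unfolding closedin_limpt Z_def by blast
      then have xD: "x \<in> D" using x by (auto simp: Z_def)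
      then obtain \<rho> where \<rho>: "\<rho> > 0" "ball x \<rho> \<subseteq> D" using D(1) openE by blast
      have "\<not> (\<exists>d>0. d \<le> \<rho> \<and> (\<forall>z\<in>ball x d - {x}. H z \<noteq> 0))"
      proof
        assume "\<exists>d>0. d \<le> \<rho> \<and> (\<forall>z\<in>ball x d - {x}. H z \<noteq> 0)"
        then obtain d where d: "d > 0" "\<forall>z\<in>ball x d - {x}. H z \<noteq> 0" by blast
        then obtain y where "y \<in> interior Z" "y \<noteq> x" "dist y x < d"
          using x unfolding islimpt_approachable by blast
        then have "y \<in> ball x d - {x}" "H y = 0"
          using interior_subset[of Z] by (auto simp: dist_commute Z_def)
        then show False using d(2) by blast
      qed
      then have "ball x \<rho> \<subseteq> Z" using dich[OF \<rho>(2,1)] \<rho>(2) by (auto simp: Z_def)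
      then show "x \<in> interior Z" using \<rho>(1) by (meson centre_in_ball interiorI open_ball)
    qed
    moreover have "openin (top_of_set (\<Omega> - F)) (interior Z)"
      using sub by (simp add: open_subset)
    moreover have "connected (\<Omega> - F)"
      using \<Omega> F(1) by (intro connected_open_delete_finite) auto
    ultimately have "interior Z = \<Omega> - F" using ne connected_clopen by blast
    then show False using nsub interior_subset[of Z] by (auto simp: Z_def)
  qed
  obtain \<rho> where \<rho>: "\<rho> > 0" "ball a \<rho> \<subseteq> D" using D(1) a openE by blast
  have "\<not> (\<forall>z\<in>ball a \<rho>. H z = 0)"
  proof
    assume "\<forall>z\<in>ball a \<rho>. H z = 0"
    then have "ball a \<rho> \<subseteq> Z" using \<rho>(2) by (auto simp: Z_def)
    then have "a \<in> interior Z" using \<rho>(1) by (meson centre_in_ball interiorI open_ball)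
    with \<open>interior Z = {}\<close> show False by simp
  qed
  then obtain d where "d > 0" "d \<le> \<rho>" "\<forall>z\<in>ball a d - {a}. H z \<noteq> 0"
    using dich[OF \<rho>(2,1)] by blast
  then show ?thesis using \<rho>(2) subset_ball by (meson order_trans)
qed

section \<open>Finiteness and number of zeros\<close>

lemma finite_compact_isolated_zeros:
  fixes H :: "complex \<Rightarrow> complex"
  assumes "compact K" "continuous_on K H"
    and iso: "\<And>a. a \<in> K \<Longrightarrow> H a = 0 \<Longrightarrow> \<exists>\<rho>>0. \<forall>z\<in>ball a \<rho> - {a}. H z \<noteq> 0"
  shows "finite {z \<in> K. H z = 0}"
proof -
  let ?Z = "{z \<in> K. H z = 0}"
  have "closedin (top_of_set K) ?Z"
    by (rule continuous_closedin_preimage_constant[OF assms(2)])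
  then have "compact ?Z" using assms(1) closedin_compact by blast
  moreover have "\<not> x islimpt ?Z" if x: "x \<in> ?Z" for x
  proof
    assume lim: "x islimpt ?Z"
    obtain \<rho> where \<rho>: "\<rho> > 0" "\<forall>z\<in>ball x \<rho> - {x}. H z \<noteq> 0" using iso x by blast
    then obtain y where "y \<in> ?Z" "y \<noteq> x" "dist y x < \<rho>"
      using lim unfolding islimpt_approachable by blast
    then show False using \<rho>(2) by (auto simp: dist_commute)
  qed
  ultimately show ?thesis using finite_not_islimpt_in_compact[of ?Z ?Z] by simp
qed

text \<open>No zero lies off \<open>D\<close>, so the zero set is compact; with
  \<open>\<Omega>\<close> the whole plane, boundedness of \<open>D\<close> excludes open sets of
  zeros.\<close>

lemma finite_zeros_inside:
  fixes H :: "complex \<Rightarrow> complex"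
  assumes D: "open D" "D \<subseteq> ball 0 r"
    and contH: "continuous_on (cball 0 r) H" and holH: "H holomorphic_on D"
    and zeros: "\<And>z. z \<in> cball 0 r \<Longrightarrow> H z = 0 \<Longrightarrow> z \<in> D"
  shows "finite {z \<in> cball 0 r. H z = 0}"
proof (rule finite_compact_isolated_zeros[OF compact_cball contH])
  fix a assume "a \<in> cball 0 r" "H a = 0"
  then have aD: "a \<in> D" using zeros by blast
  have "{z \<in> D. H z = 0} \<union> {} = {z \<in> cball 0 r. H z = 0}" using zeros D(2) by fastforce
  moreover have "closed {z \<in> cball 0 r. H z = 0}"
    using continuous_closedin_preimage_constant[OF contH, of 0] closedin_closed_trans closed_cball by blast
  moreover have "\<not> UNIV - {} \<subseteq> D"
    using D(2) by (metis Diff_empty bounded_ball bounded_subset not_bounded_UNIV)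
  ultimately have "\<exists>\<rho>>0. ball a \<rho> \<subseteq> D \<and> (\<forall>z\<in>ball a \<rho> - {a}. H z \<noteq> 0)"
    by (intro isolated_zeros_of_closed_zero_set[OF open_UNIV connected_UNIV D(1) subset_UNIV holH finite.emptyI _ _ _ aD])
       (simp_all only: subtopology_UNIV closed_closedin[symmetric] Int_empty_left not_False_eq_True)
  then show "\<exists>\<rho>>0. \<forall>z\<in>ball a \<rho> - {a}. H z \<noteq> 0" by blast
qed

lemma degree_of_omitted_value:
  fixes H :: "complex \<Rightarrow> complex"
  assumes D: "open D" "D \<subseteq> ball 0 r" and r: "r > 0"
    and contH: "continuous_on (cball 0 r) H" and holH: "H holomorphic_on D"
    and c: "\<And>z. z \<in> cball 0 r - D \<Longrightarrow> H z \<noteq> c"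
  obtains k g where "finite {z \<in> D. H z = c}" "card {z \<in> D. H z = c} \<le> k" "continuous_on (sphere 0 r) g"
    "\<And>z. z \<in> sphere 0 r \<Longrightarrow> H z - c = z ^ k * exp (g z)"
proof -
  have cont: "continuous_on (cball 0 r) (\<lambda>z. H z - c)" by (intro continuous_intros contH)
  have hol: "(\<lambda>z. H z - c) holomorphic_on D" by (intro holomorphic_intros holH)
  have zeros: "z \<in> D" if "z \<in> cball 0 r" "H z - c = 0" for z using c that by auto
  have fin: "finite {z \<in> cball 0 r. H z - c = 0}"
    by (rule finite_zeros_inside[OF D cont hol zeros])
  have eq: "{z \<in> cball 0 r. H z - c = 0} = {z \<in> D. H z = c}"
    using zeros D(2) by fastforce
  show ?thesis
    using degree_ge_card_zeros[OF D r cont hol zeros fin] fin that unfolding eq by blast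
qed

text \<open>A value omitted off \<open>D\<close> arbitrarily close to 0 turns the zeros of \<open>H\<close> into solutions of
  \<open>H z = c\<close>, all of which lie in \<open>D\<close> and are therefore counted by the degree on the circle.\<close>

lemma card_zeros_le_degree:
  fixes H E g :: "complex \<Rightarrow> complex"
  assumes D: "open D" "D \<subseteq> ball 0 r" and r: "r > 0"
    and contH: "continuous_on (cball 0 r) H" and holH: "H holomorphic_on D"
    and omit: "\<And>\<epsilon>. \<epsilon> > 0 \<Longrightarrow> \<exists>c. norm c < \<epsilon> \<and> (\<forall>z\<in>cball 0 r - D. H z \<noteq> c)"
    and iso: "\<And>a. a \<in> D \<Longrightarrow> H a = 0 \<Longrightarrow> \<exists>\<rho>>0. ball a \<rho> \<subseteq> D \<and> (\<forall>z\<in>ball a \<rho> - {a}. H z \<noteq> 0)"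
    and contE: "continuous_on (sphere 0 r) E" and contg: "continuous_on (sphere 0 r) g"
    and E: "\<And>z. z \<in> sphere 0 r \<Longrightarrow> E z = z ^ k * exp (g z)"
    and m: "m > 0" "\<And>z. z \<in> sphere 0 r \<Longrightarrow> m \<le> norm (E z)"
    and near: "\<And>z. z \<in> sphere 0 r \<Longrightarrow> norm (H z - E z) \<le> norm (E z) / 2"
  shows "finite {z \<in> D. H z = 0}" "card {z \<in> D. H z = 0} \<le> k"
proof -
  \<comment> \<open>Finiteness of the zero set is not yet known, as zeros may accumulate at points
    off \<open>D\<close>. Bounding the size of its finite subsets yields both claims.\<close>
  have main: "card X \<le> k" if X: "finite X" "X \<subseteq> {z \<in> D. H z = 0}" for X
  proof -
    have XD: "X \<subseteq> D" using X(2) by blast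
    obtain e where e: "e > 0" "\<And>a. a \<in> X \<Longrightarrow> ball a e \<subseteq> D" "disjoint_family_on (\<lambda>a. ball a e) X"
      using disjoint_balls_around_finite[OF X(1) D(1) XD] by metis
    have "open (\<Inter>a\<in>X. H ` ball a e)"
    proof (intro open_INT X(1) ballI)
      fix a assume a: "a \<in> X"
      then obtain \<rho> where \<rho>: "\<rho> > 0" "\<forall>z\<in>ball a \<rho> - {a}. H z \<noteq> 0" using iso X(2) by blast
      have "\<not> H constant_on ball a e"
      proof
        assume "H constant_on ball a e"
        moreover have "H a = 0" using a X(2) by auto
        ultimately have zero: "\<And>z. z \<in> ball a e \<Longrightarrow> H z = 0"
          using e(1) unfolding constant_on_def by (metis centre_in_ball)
        define b where "b = a + of_real (min e \<rho> / 2)"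
        have "b \<in> ball a e" "b \<in> ball a \<rho> - {a}"
          using e(1) \<rho>(1) by (auto simp: b_def dist_norm)
        then show False using zero \<rho>(2) by blast
      qed
      then show "open (H ` ball a e)"
        using e(2)[OF a] holomorphic_on_subset[OF holH]
        by (intro open_mapping_thm[of H "ball a e"]) auto
    qed
    moreover have "0 \<in> (\<Inter>a\<in>X. H ` ball a e)" using X(2) e(1) by force
    ultimately obtain \<tau> where \<tau>: "\<tau> > 0" "ball 0 \<tau> \<subseteq> (\<Inter>a\<in>X. H ` ball a e)" by (meson openE)
    \<comment> \<open>\<open>\<tau>\<close> ensures that \<open>c\<close> is attained near every
      point of \<open>X\<close>; \<open>m / 4\<close> keeps \<open>H z - c\<close> close to
      \<open>E z\<close> on the circle.\<close>
    obtain c where c: "norm c < min \<tau> (m / 4)" "\<And>z. z \<in> cball 0 r - D \<Longrightarrow> H z \<noteq> c"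
      using omit[of "min \<tau> (m / 4)"] \<tau>(1) m(1) by auto
    obtain l h where l: "finite {z \<in> D. H z = c}" "card {z \<in> D. H z = c} \<le> l" and h: "continuous_on (sphere 0 r) h"
      "\<And>z. z \<in> sphere 0 r \<Longrightarrow> H z - c = z ^ l * exp (h z)"
      using degree_of_omitted_value[OF D r contH holH c(2)] by blast
    have "\<exists>q. \<forall>a\<in>X. q a \<in> ball a e \<and> H (q a) = c"
    proof (intro bchoice ballI)
      fix a assume "a \<in> X"
      then have "c \<in> H ` ball a e" using \<tau>(2) c(1) by auto
      then show "\<exists>z. z \<in> ball a e \<and> H z = c" by blast
    qed
    then obtain q where q: "\<And>a. a \<in> X \<Longrightarrow> q a \<in> ball a e \<and> H (q a) = c" by blast
    have "inj_on q X"
      using q e(3) by (intro inj_onI) (fastforce simp: disjoint_family_on_def)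
    moreover have "q ` X \<subseteq> {z \<in> D. H z = c}" using q e(2) by blast
    ultimately have "card X \<le> l" using card_inj_on_le[OF _ _ l(1)] l(2) order_trans by blast
    have Enz: "E z \<noteq> 0" if "z \<in> sphere 0 r" for z using m(1) m(2)[OF that] by auto
    \<comment> \<open>Relative to \<open>E z\<close>, the error is at most one half from
      \<open>near\<close> and at most one quarter from \<open>c\<close>. So the quotient has a
      continuous logarithm on the circle and both functions have the same degree.\<close>
    have Re_pos: "Re ((H z - c) / E z) > 0" if z: "z \<in> sphere 0 r" for z
    proof -
      have "norm (H z - c - E z) \<le> norm (H z - E z) + norm c"
        using norm_triangle_ineq4[of "H z - E z" c] by (simp add: algebra_simps)
      also have "\<dots> < norm (E z)" using near[OF z] c(1) m(1) m(2)[OF z] by linarith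
      finally have "norm ((H z - c) / E z - 1) < 1"
        using Enz[OF z] by (simp add: divide_simps norm_divide)
      then have "\<bar>Re ((H z - c) / E z - 1)\<bar> < 1" using abs_Re_le_cmod order_le_less_trans by blast
      then show ?thesis by simp
    qed
    define G where "G = (\<lambda>z. g z + Ln ((H z - c) / E z))"
    have "continuous_on (sphere 0 r) (\<lambda>z. (H z - c) / E z)"
      using Enz by (intro continuous_intros contE continuous_on_subset[OF contH]) auto
    then have "continuous_on (sphere 0 r) (\<lambda>z. Ln ((H z - c) / E z))"
      using Re_pos by (intro continuous_on_Ln') (force simp: complex_nonpos_Reals_iff)+
    then have "continuous_on (sphere 0 r) G" unfolding G_def by (intro continuous_on_add contg)
    moreover have "z ^ l * exp (h z) = z ^ k * exp (G z)" if z: "z \<in> sphere 0 r" for z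
    proof -
      have nz: "(H z - c) / E z \<noteq> 0" using Re_pos[OF z] by auto
      have "exp (G z) = exp (g z) * ((H z - c) / E z)"
        unfolding G_def exp_add exp_Ln[OF nz] ..
      then have "z ^ k * exp (G z) = (z ^ k * exp (g z)) * ((H z - c) / E z)" by simp
      also have "\<dots> = H z - c" using Enz[OF z] unfolding E[OF z, symmetric] by simp
      finally show ?thesis using h(2)[OF z] by simp
    qed
    ultimately have "l = k" by (intro power_exp_degree_unique[OF r h(1)])
    with \<open>card X \<le> l\<close> show ?thesis by simp
  qed
  show fin: "finite {z \<in> D. H z = 0}"
  proof (rule ccontr)
    assume "infinite {z \<in> D. H z = 0}"
    then obtain X where "finite X" "card X = Suc k" "X \<subseteq> {z \<in> D. H z = 0}"
      using infinite_arbitrarily_large by blast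
    then show False using main[of X] by simp
  qed
  show "card {z \<in> D. H z = 0} \<le> k" using main[OF fin] by simp
qed

text \<open>The form with two functions covers both \<open>S z / z\<close> near a finite value and
  \<open>z / S z\<close> near 0. Inside the disc but off \<open>D\<close> both have the same norm,
  so for \<open>norm u \<noteq> 1\<close> the combination \<open>A - u * B\<close> vanishes there at
  most at 0; its zeros in \<open>D\<close> are the points where the quotient is
  \<open>u\<close>.\<close>

theorem pencil_quotient_avoids_value:
  fixes A B :: "complex \<Rightarrow> complex"
  assumes D: "open D" "D \<subseteq> ball 0 r" "0 \<notin> D" and r: "r > 0" and d: "d > 0"
    and contA: "continuous_on (cball 0 r) A" and contB: "continuous_on (cball 0 r) B"
    and holA: "A holomorphic_on D" and holB: "B holomorphic_on D"
    and common: "\<And>z. z \<in> cball 0 r \<Longrightarrow> A z = 0 \<Longrightarrow> B z = 0 \<Longrightarrow> z = 0"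
    and norm_eq: "\<And>z. z \<in> ball 0 r - D \<Longrightarrow> norm (A z) = norm (B z)"
    and unit: "\<And>u. u \<in> ball w d \<Longrightarrow> norm u \<noteq> 1"
    and sph: "\<And>z. z \<in> sphere 0 r \<Longrightarrow> A z \<noteq> w * B z"
    and omit: "\<And>u \<epsilon>. u \<in> ball w d \<Longrightarrow> \<epsilon> > 0 \<Longrightarrow>
      \<exists>c. norm c < \<epsilon> \<and> (\<forall>z\<in>ball 0 r - D. A z - u * B z \<noteq> c)"
    and nonisolated: "\<And>\<epsilon>. \<epsilon> > 0 \<Longrightarrow> \<not> ball 0 \<epsilon> - {0} \<subseteq> D"
  shows "\<exists>\<epsilon>>0. \<forall>z\<in>D. norm z < \<epsilon> \<longrightarrow> B z \<noteq> 0 \<longrightarrow> \<epsilon> \<le> dist w (A z / B z)"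
proof -
  have sphere_ne: "sphere (0::complex) r \<noteq> {}" using r by simp
  have "continuous_on (sphere 0 r) (\<lambda>z. norm (A z - w * B z))"
    by (intro continuous_intros continuous_on_subset[OF contA] continuous_on_subset[OF contB]) auto
  then obtain z1 where z1: "z1 \<in> sphere 0 r"
      "\<And>z. z \<in> sphere 0 r \<Longrightarrow> norm (A z1 - w * B z1) \<le> norm (A z - w * B z)"
    using continuous_attains_inf[OF compact_sphere sphere_ne] by blast
  define m where "m = norm (A z1 - w * B z1)"
  have m: "m > 0" "\<And>z. z \<in> sphere 0 r \<Longrightarrow> m \<le> norm (A z - w * B z)"
    using sph[OF z1(1)] z1(2) by (auto simp: m_def)
  obtain b where b: "b > 0" "\<And>z. z \<in> cball 0 r \<Longrightarrow> norm (B z) \<le> b"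
    using compact_continuous_image[OF contB compact_cball]
    by (metis bounded_pos compact_imp_bounded imageI)
  \<comment> \<open>With \<open>m / (8 * b)\<close>, replacing \<open>w\<close> by \<open>u\<close>
    changes \<open>A - w * B\<close> by at most \<open>m / 8\<close> on the closed disc, so the
    bounds on the circle hold for all these \<open>u\<close> at once.\<close>
  define \<delta> where "\<delta> = min d (m / (8 * b))"
  have \<delta>: "\<delta> > 0" "\<delta> \<le> d" "\<delta> * b \<le> m / 8"
  proof -
    show "\<delta> > 0" "\<delta> \<le> d" using d m(1) b(1) by (auto simp: \<delta>_def)
    have "\<delta> \<le> m / (8 * b)" by (simp add: \<delta>_def)
    then show "\<delta> * b \<le> m / 8" using b(1) by (simp add: field_simps)
  qed
  define H where "H = (\<lambda>u z. A z - u * B z)"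
  have contH: "continuous_on (cball 0 r) (H u)" for u
    unfolding H_def by (intro continuous_intros contA contB)
  have holH: "H u holomorphic_on D" for u
    unfolding H_def by (intro holomorphic_intros holA holB)
  have diff: "norm (H u z - H w z) \<le> m / 8" if u: "u \<in> ball w \<delta>" and z: "z \<in> cball 0 r" for u z
  proof -
    have "norm (H u z - H w z) = norm (w - u) * norm (B z)"
      by (simp add: H_def norm_mult[symmetric] algebra_simps)
    also have "\<dots> \<le> \<delta> * b" using u b(2)[OF z] \<delta>(1) by (intro mult_mono) (auto simp: dist_norm)
    finally show ?thesis using \<delta>(3) by simp
  qed
  have sphere_lower: "m / 2 < norm (H u z)" if u: "u \<in> ball w \<delta>" and z: "z \<in> sphere 0 r" for u z
  proof -
    have "m \<le> norm (H w z)" using m(2)[OF z] by (simp add: H_def)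
    then show ?thesis
      using diff[OF u, of z] z norm_triangle_ineq2[of "H w z" "H w z - H u z"] m(1)
      by (simp add: norm_minus_commute)
  qed
  have u_unit: "norm u \<noteq> 1" if "u \<in> ball w \<delta>" for u using unit that \<delta>(2) by auto
  have zeros: "z \<in> D \<or> z = 0" if u: "u \<in> ball w \<delta>" and z: "z \<in> cball 0 r" "H u z = 0" for u z
  proof (rule ccontr)
    assume not: "\<not> ?thesis"
    have "z \<notin> sphere 0 r" using sphere_lower[OF u, of z] z(2) m(1) by auto
    then have "norm (A z) = norm (B z)" using z(1) not by (intro norm_eq) auto
    moreover have "A z = u * B z" using z(2) by (simp add: H_def)
    ultimately have "norm u * norm (B z) = norm (B z)" by (simp add: norm_mult)
    then have "B z = 0" using u_unit[OF u] by simp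
    then show False using common[OF z(1)] \<open>A z = u * B z\<close> not by simp
  qed
  have omitH: "\<exists>c. norm c < \<epsilon> \<and> (\<forall>z\<in>cball 0 r - D. H u z \<noteq> c)"
    if u: "u \<in> ball w \<delta>" and \<epsilon>: "\<epsilon> > 0" for u \<epsilon>
  proof -
    obtain c where c: "norm c < min \<epsilon> (m / 2)" "\<forall>z\<in>ball 0 r - D. A z - u * B z \<noteq> c"
      using omit[of u "min \<epsilon> (m / 2)"] u \<delta>(2) \<epsilon> m(1) by auto
    have "H u z \<noteq> c" if z: "z \<in> cball 0 r - D" for z
    proof (cases "z \<in> sphere 0 r")
      case True
      then show ?thesis using sphere_lower[OF u True] c(1) by auto
    next
      case False
      then show ?thesis using z c(2) by (auto simp: H_def)
    qed
    then show ?thesis using c(1) by (intro exI[of _ c]) simp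
  qed
  have closedZ: "closed {z \<in> cball 0 r. H u z = 0}" for u
    by (rule closedin_closed_trans[OF continuous_closedin_preimage_constant[OF contH] closed_cball])
  \<comment> \<open>The point 0 is adjoined as \<open>F\<close> because the zeros in
    \<open>D\<close> may accumulate there.\<close>
  have iso: "\<exists>\<rho>>0. ball a \<rho> \<subseteq> D \<and> (\<forall>z\<in>ball a \<rho> - {a}. H u z \<noteq> 0)"
    if u: "u \<in> ball w \<delta>" and a: "a \<in> D" for u a
  proof (rule isolated_zeros_of_closed_zero_set[OF open_UNIV connected_UNIV D(1) subset_UNIV holH, of "{0}"])
    show "\<not> UNIV - {0} \<subseteq> D" using nonisolated[OF zero_less_one] by blast
    have "{z \<in> D. H u z = 0} \<union> {0} = insert 0 {z \<in> cball 0 r. H u z = 0}"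
      using zeros[OF u] D(2) by fastforce
    then have "closed ({z \<in> D. H u z = 0} \<union> {0})" using closedZ closed_insert by metis
    then show "closedin (top_of_set UNIV) ({z \<in> D. H u z = 0} \<union> {0})"
      by (simp only: subtopology_UNIV closed_closedin[symmetric])
  qed (use D(3) a in auto)
  have w\<delta>: "w \<in> ball w \<delta>" using \<delta>(1) by simp
  \<comment> \<open>The reference function \<open>H w z - c0\<close> gives one degree
    \<open>k\<close> for all \<open>u\<close>: the deviations \<open>m / 4\<close> and
    \<open>m / 8\<close> add up to half of its lower bound \<open>3 * m / 4\<close> on the
    circle.\<close>
  obtain c0 where c0: "norm c0 < m / 4" "\<And>z. z \<in> cball 0 r - D \<Longrightarrow> H w z \<noteq> c0"
    using omitH[OF w\<delta>, of "m / 4"] m(1) by auto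
  obtain k g where g: "continuous_on (sphere 0 r) g" "\<And>z. z \<in> sphere 0 r \<Longrightarrow> H w z - c0 = z ^ k * exp (g z)"
    using degree_of_omitted_value[OF D(1,2) r contH holH c0(2)] by metis
  have E_lower: "3 * m / 4 \<le> norm (H w z - c0)" if z: "z \<in> sphere 0 r" for z
    using m(2)[OF z] c0(1) norm_triangle_ineq2[of "H w z" c0] by (simp add: H_def)
  have near: "norm (H u z - (H w z - c0)) \<le> norm (H w z - c0) / 2"
    if u: "u \<in> ball w \<delta>" and z: "z \<in> sphere 0 r" for u z
  proof -
    have "H u z - (H w z - c0) = (H u z - H w z) + c0" by simp
    then have "norm (H u z - (H w z - c0)) \<le> norm (H u z - H w z) + norm c0"
      using norm_triangle_ineq by metis
    moreover have "norm (H u z - H w z) \<le> m / 8" using diff[OF u, of z] z by simp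
    ultimately show ?thesis using c0(1) E_lower[OF z] by linarith
  qed
  have contE: "continuous_on (sphere 0 r) (\<lambda>z. H w z - c0)"
    by (intro continuous_intros continuous_on_subset[OF contH]) auto
  have fibres: "finite {z \<in> D. H u z = 0}" "card {z \<in> D. H u z = 0} \<le> k" if u: "u \<in> ball w \<delta>" for u
  proof -
    have m34: "3 * m / 4 > 0" using m(1) by simp
    note * = card_zeros_le_degree[OF D(1,2) r contH holH omitH[OF u] iso[OF u] contE g m34 E_lower near[OF u]]
    show "finite {z \<in> D. H u z = 0}" "card {z \<in> D. H u z = 0} \<le> k" using * by blast+
  qed
  define W where "W = {z \<in> D. B z \<noteq> 0 \<and> A z / B z \<in> ball w \<delta>}"
  define f where "f = (\<lambda>z. A z / B z)"
  have openD': "open (D \<inter> B -` (-{0}))"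
    using D(1) holB holomorphic_on_imp_continuous_on by (intro continuous_open_preimage) auto
  have holf': "f holomorphic_on D \<inter> B -` (-{0})"
    unfolding f_def by (intro holomorphic_intros holomorphic_on_subset[OF holA] holomorphic_on_subset[OF holB]) auto
  have W_eq: "W = (D \<inter> B -` (-{0})) \<inter> f -` ball w \<delta>" by (auto simp: W_def f_def)
  have openW: "open W"
    unfolding W_eq
    by (rule continuous_open_preimage[OF holomorphic_on_imp_continuous_on[OF holf'] openD' open_ball])
  have holf: "f holomorphic_on W" using holf' by (rule holomorphic_on_subset) (auto simp: W_eq)
  have fibre_sub: "{z \<in> W. f z = u} \<subseteq> {z \<in> D. H u z = 0}" for u
    by (auto simp: W_def f_def H_def)
  have fibre_empty: "{z \<in> W. f z = u} = {}" if "u \<notin> ball w \<delta>" for u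
    using that by (auto simp: W_def f_def)
  have W_fin: "finite {z \<in> W. f z = u}" and W_card: "card {z \<in> W. f z = u} \<le> k" for u
  proof -
    show "finite {z \<in> W. f z = u}"
    proof (cases "u \<in> ball w \<delta>")
      case True
      then show ?thesis using finite_subset[OF fibre_sub fibres(1)] by simp
    next
      case False
      show ?thesis unfolding fibre_empty[OF False] by simp
    qed
    show "card {z \<in> W. f z = u} \<le> k"
    proof (cases "u \<in> ball w \<delta>")
      case True
      then show ?thesis using card_mono[OF fibres(1) fibre_sub] fibres(2)[OF True] by fastforce
    next
      case False
      show ?thesis unfolding fibre_empty[OF False] by simp
    qed
  qed
  \<comment> \<open>Up to the point 0, the preimage of \<open>K\<close> is the projection of the
    compact set of pairs \<open>(z, u)\<close> with \<open>A z = u * B z\<close>, an equation that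
    stays meaningful at zeros of \<open>B\<close>.\<close>
  have proper: "compact (insert 0 {z \<in> W. f z \<in> K})" if K: "compact K" "K \<subseteq> ball w \<delta>" for K
  proof -
    define Y where "Y = {p \<in> cball 0 r \<times> K. A (fst p) - snd p * B (fst p) = 0}"
    have contY: "continuous_on (cball 0 r \<times> K) (\<lambda>p. A (fst p) - snd p * B (fst p))"
      by (intro continuous_intros continuous_on_compose2[OF contA] continuous_on_compose2[OF contB]) auto
    have "closedin (top_of_set (cball 0 r \<times> K)) Y"
      unfolding Y_def by (rule continuous_closedin_preimage_constant[OF contY])
    then have "compact Y" using closedin_compact[OF compact_Times[OF compact_cball K(1)]] by blast
    then have "compact (insert 0 (fst ` Y))"
      by (intro compact_insert compact_continuous_image continuous_on_fst continuous_on_id)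
    moreover have "insert 0 (fst ` Y) = insert 0 {z \<in> W. f z \<in> K}"
    proof (intro equalityI subsetI)
      fix z assume "z \<in> insert 0 (fst ` Y)"
      then consider "z = 0" | "z \<noteq> 0" "z \<in> fst ` Y" by blast
      then show "z \<in> insert 0 {z \<in> W. f z \<in> K}"
      proof cases
        case 2
        then obtain u where u: "u \<in> K" "z \<in> cball 0 r" "H u z = 0" by (auto simp: Y_def H_def)
        then have uw: "u \<in> ball w \<delta>" using K(2) by blast
        have zD: "z \<in> D" using zeros[OF uw u(2,3)] 2(1) by blast
        have Az: "A z = u * B z" using u(3) by (simp add: H_def)
        then have "B z \<noteq> 0" using common[OF u(2)] 2(1) by auto
        then have "f z = u" using Az by (simp add: f_def)
        then show ?thesis using zD \<open>B z \<noteq> 0\<close> u(1) uw by (simp add: W_def f_def)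
      qed simp
    next
      fix z assume "z \<in> insert 0 {z \<in> W. f z \<in> K}"
      then consider "z = 0" | "z \<in> W" "f z \<in> K" by blast
      then show "z \<in> insert 0 (fst ` Y)"
      proof cases
        case 2
        then have "(z, f z) \<in> Y" using D(2) by (auto simp: W_def Y_def f_def)
        then show ?thesis by force
      qed simp
    qed
    ultimately show ?thesis by simp
  qed
  show ?thesis
  proof (rule ccontr)
    assume contra: "\<not> ?thesis"
    have "\<exists>\<epsilon>>0. ball 0 \<epsilon> - {0} \<subseteq> W"
    proof (rule punctured_neighbourhood_of_finite_fibres[OF holf openW _ _ _ W_fin W_card proper])
      show "bounded W" using D(2) by (intro bounded_subset[OF bounded_ball[of 0 r]]) (auto simp: W_def)
      show "0 \<notin> W" using D(3) by (auto simp: W_def)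
      show "f ` W \<subseteq> ball w \<delta>" by (auto simp: W_def f_def)
      fix \<epsilon> :: real assume \<epsilon>: "\<epsilon> > 0"
      then obtain z where "z \<in> D" "norm z < min \<epsilon> \<delta>" "B z \<noteq> 0" "dist w (A z / B z) < min \<epsilon> \<delta>"
        using contra \<delta>(1) by (metis min_less_iff_conj not_le)
      then show "\<exists>z\<in>W. norm z < \<epsilon> \<and> dist w (f z) < \<epsilon>"
        by (intro bexI[of _ z]) (auto simp: W_def f_def)
    qed
    moreover have "W \<subseteq> D" by (auto simp: W_def)
    ultimately show False using nonisolated by (meson order_trans)
  qed
qed

subsection \<open>Schwarz functions\<close>

text \<open>The difference has the same norm as its conjugate, while the equation rescales it by
  \<open>norm u \<noteq> 1\<close>, so it is 0.\<close>

lemma inj_cnj_pencil: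
  assumes "norm u \<noteq> 1" "cnj z - u * z = cnj z' - u * z'"
  shows "z = z'"
proof -
  have "cnj (z - z') = u * (z - z')" using assms(2) by (simp add: algebra_simps)
  then have "norm (z - z') = norm u * norm (z - z')"
    by (metis complex_mod_cnj norm_mult)
  then show ?thesis using assms(1) by simp
qed

lemma inj_cnj_pencil':
  assumes "norm u \<noteq> 1" "z - u * cnj z = z' - u * cnj z'"
  shows "z = z'"
proof -
  have "z - z' = u * cnj (z - z')" using assms(2) by (simp add: algebra_simps)
  then have "norm (z - z') = norm u * norm (z - z')"
    by (metis complex_mod_cnj norm_mult)
  then show ?thesis using assms(1) by simp
qed

text \<open>The zeros other than 0 are isolated, so only finitely many lie in a closed annulus
  around 0, and some radius within it misses all their norms.\<close>

lemma radius_avoiding_zeros: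
  fixes H :: "complex \<Rightarrow> complex"
  assumes D: "open D" "D \<subseteq> ball 0 1" "0 \<notin> D" and notD: "\<not> ball 0 1 - {0} \<subseteq> D"
    and contH: "continuous_on (ball 0 1) H" and holH: "H holomorphic_on D" and H0: "H 0 = 0"
    and zeros: "\<And>z. z \<in> ball 0 1 \<Longrightarrow> H z = 0 \<Longrightarrow> z \<noteq> 0 \<Longrightarrow> z \<in> D"
  obtains r where "0 < r" "r < 1" "\<And>z. z \<in> sphere 0 r \<Longrightarrow> H z \<noteq> 0"
proof -
  have eq: "{z \<in> D. H z = 0} \<union> {0} = {z \<in> ball 0 1. H z = 0}"
    using zeros D(2) H0 by auto
  have clo: "closedin (top_of_set (ball 0 1)) ({z \<in> D. H z = 0} \<union> {0})"
    unfolding eq by (rule continuous_closedin_preimage_constant[OF contH])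
  define K where "K = cball (0::complex) (2/3) - ball 0 (1/3)"
  have K: "compact K" "K \<subseteq> ball 0 1" "0 \<notin> K"
    unfolding K_def by (auto intro: compact_diff)
  have "finite {z \<in> K. H z = 0}"
  proof (rule finite_compact_isolated_zeros[OF K(1) continuous_on_subset[OF contH K(2)]])
    fix a assume a: "a \<in> K" "H a = 0"
    then have "a \<in> D" using zeros K(2,3) by blast
    then have "\<exists>\<rho>>0. ball a \<rho> \<subseteq> D \<and> (\<forall>z\<in>ball a \<rho> - {a}. H z \<noteq> 0)"
      using D(3) notD
      by (intro isolated_zeros_of_closed_zero_set[OF open_ball connected_ball D(1,2) holH _ _ _ clo]) auto
    then show "\<exists>\<rho>>0. \<forall>z\<in>ball a \<rho> - {a}. H z \<noteq> 0" by blast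
  qed
  then have "finite (norm ` {z \<in> K. H z = 0})" by simp
  moreover have "infinite {1/3::real<..<2/3}" by (simp add: infinite_Ioo)
  ultimately obtain r where r: "r \<in> {1/3<..<2/3}" "r \<notin> norm ` {z \<in> K. H z = 0}"
    by (meson finite_subset subsetI)
  show ?thesis
  proof (rule that[of r])
    fix z :: complex assume "z \<in> sphere 0 r"
    then have "norm z = r" "z \<in> K" using r(1) by (auto simp: K_def)
    then show "H z \<noteq> 0" using r(2) by auto
  qed (use r in auto)
qed

theorem proposition3p1:
  fixes D \<Gamma> :: "complex set" and S :: "complex \<Rightarrow> complex"
  assumes "open D"
    and "D \<subseteq> ball 0 1"
    and "0 \<in> frontier D"
    and "\<Gamma> = frontier D \<inter> ball 0 1"
    and "\<not> 0 isolated_in \<Gamma>"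
    and "continuous_on (D \<union> \<Gamma>) S"
    and "S holomorphic_on D"
    and "\<And>z. z \<in> \<Gamma> \<Longrightarrow> S z = cnj z"
  shows "((\<lambda>z. cmod (S z / z)) \<longlongrightarrow> 1) (at 0 within D)"
proof -
  note D = assms(1,2) and holS = assms(7)
  have D0: "0 \<notin> D" "0 \<in> closure D"
    using assms(1,3) by (auto simp: frontier_def interior_open)
  \<comment> \<open>\<open>D \<union> \<Gamma>\<close> and the complement of \<open>D\<close> are
    relatively closed in the disc, and on their overlap \<open>\<Gamma>\<close> both formulas give
    \<open>cnj z\<close>; hence \<open>T\<close> is continuous.\<close>
  define T where "T = (\<lambda>z. if z \<in> D then S z else cnj z)"
  have D\<Gamma>: "D \<union> \<Gamma> = closure D \<inter> ball 0 1"
    using D by (auto simp: assms(4) frontier_def interior_open closure_subset[THEN subsetD])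
  have T_S: "T z = S z" if "z \<in> D \<union> \<Gamma>" for z
    using that assms(8) by (auto simp: T_def)
  have contT: "continuous_on (ball 0 1) T"
  proof -
    have un: "(D \<union> \<Gamma>) \<union> (ball 0 1 - D) = ball 0 1" using D\<Gamma> by auto
    have "continuous_on ((D \<union> \<Gamma>) \<union> (ball 0 1 - D)) T"
    proof (rule continuous_on_Un_local)
      show "closedin (top_of_set (D \<union> \<Gamma> \<union> (ball 0 1 - D))) (D \<union> \<Gamma>)"
        unfolding un unfolding D\<Gamma> by (metis closed_closure closedin_closed_Int Int_commute)
      show "closedin (top_of_set (D \<union> \<Gamma> \<union> (ball 0 1 - D))) (ball 0 1 - D)"
        unfolding un using D(1) by (metis Diff_eq closed_Compl closedin_closed_Int)
      show "continuous_on (D \<union> \<Gamma>) T"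
        using assms(6) by (rule continuous_on_eq) (simp add: T_S)
      have "continuous_on (ball 0 1 - D) cnj" by (intro continuous_intros)
      then show "continuous_on (ball 0 1 - D) T" by (rule continuous_on_eq) (simp add: T_def)
    qed
    then show ?thesis unfolding un .
  qed
  have holT: "T holomorphic_on D"
    using holS by (rule holomorphic_transform) (simp add: T_def)
  have T0: "T 0 = 0" using D0(1) by (simp add: T_def)
  have nonisolated: "\<not> ball 0 \<epsilon> - {0} \<subseteq> D" if \<epsilon>: "\<epsilon> > 0" for \<epsilon>
  proof
    assume sub: "ball 0 \<epsilon> - {0} \<subseteq> D"
    have "0 \<in> \<Gamma>" using assms(3,4) by simp
    moreover have "ball 0 \<epsilon> \<inter> \<Gamma> \<subseteq> {0}"
      using sub D(1) by (auto simp: assms(4) frontier_def interior_open)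
    ultimately have "0 isolated_in \<Gamma>"
      using \<epsilon> unfolding isolated_in_def by (intro conjI exI[of _ "ball 0 \<epsilon>"]) auto
    then show False using assms(5) by simp
  qed
  have small_point: "\<exists>z0\<in>D. norm z0 < \<epsilon>" if "\<epsilon> > 0" for \<epsilon>
    using D0(2) that by (auto simp: closure_approachable)
  have avoid: "\<exists>\<epsilon>>0. \<forall>z\<in>D. norm z < \<epsilon> \<longrightarrow> \<epsilon> \<le> dist w (S z / z)" if w: "norm w \<noteq> 1" for w
  proof -
    obtain d where d: "d > 0" "\<And>u. u \<in> ball w d \<Longrightarrow> norm u \<noteq> 1"
    proof (rule that[of "\<bar>norm w - 1\<bar>"])
      fix u assume "u \<in> ball w \<bar>norm w - 1\<bar>"
      then show "norm u \<noteq> 1" using norm_triangle_ineq3[of w u] by (auto simp: dist_norm)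
    qed (use w in simp)
    obtain r where r: "0 < r" "r < 1" "\<And>z. z \<in> sphere 0 r \<Longrightarrow> T z - w * z \<noteq> 0"
    proof (rule radius_avoiding_zeros[OF D D0(1) nonisolated[OF zero_less_one], of "\<lambda>z. T z - w * z"])
      show "continuous_on (ball 0 1) (\<lambda>z. T z - w * z)" by (intro continuous_intros contT)
      show "(\<lambda>z. T z - w * z) holomorphic_on D" by (intro holomorphic_intros holT)
      show "z \<in> D" if "T z - w * z = 0" "z \<noteq> 0" for z
        using that inj_cnj_pencil[OF w, of z 0] by (auto simp: T_def split: if_splits)
    qed (use T0 in auto)
    have cb: "cball 0 r \<subseteq> ball (0::complex) 1" using r(2) by auto
    have "\<exists>\<epsilon>>0. \<forall>z\<in>D \<inter> ball 0 r. norm z < \<epsilon> \<longrightarrow> z \<noteq> 0 \<longrightarrow> \<epsilon> \<le> dist w (T z / z)"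
    proof (rule pencil_quotient_avoids_value[where B = "\<lambda>z. z", OF _ _ _ r(1) d(1)])
      show "continuous_on (cball 0 r) T" using contT cb continuous_on_subset by blast
      show "T holomorphic_on D \<inter> ball 0 r" using holT by (rule holomorphic_on_subset) auto
      show "norm (T z) = norm z" if "z \<in> ball 0 r - D \<inter> ball 0 r" for z
        using that by (auto simp: T_def)
      show "norm u \<noteq> 1" if "u \<in> ball w d" for u using d(2)[OF that] .
      show "T z \<noteq> w * z" if "z \<in> sphere 0 r" for z using r(3)[OF that] by simp
      show "\<not> ball 0 \<epsilon> - {0} \<subseteq> D \<inter> ball 0 r" if "\<epsilon> > 0" for \<epsilon>
        using nonisolated[OF that] by blast
      show "\<exists>c. norm c < \<epsilon> \<and> (\<forall>z\<in>ball 0 r - D \<inter> ball 0 r. T z - u * z \<noteq> c)"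
        if u: "u \<in> ball w d" and \<epsilon>: "\<epsilon> > 0" for u \<epsilon>
      proof -
        have pos: "1 + norm u > 0" by (simp add: add_pos_nonneg)
        \<comment> \<open>The omitted value is \<open>cnj z0 - u * z0\<close>: by
          \<open>inj_cnj_pencil\<close>, off \<open>D\<close> it could be taken only at
          \<open>z0\<close>, which lies in \<open>D\<close>. Its norm is at most
          \<open>(1 + norm u) * norm z0\<close>.\<close>
        obtain z0 where z0: "z0 \<in> D" "norm z0 < \<epsilon> / (1 + norm u)"
          using small_point[of "\<epsilon> / (1 + norm u)"] \<epsilon> pos by auto
        have "norm (cnj z0 - u * z0) \<le> norm z0 + norm u * norm z0"
          using norm_triangle_ineq4[of "cnj z0" "u * z0"] by (simp add: norm_mult)
        also have "\<dots> = norm z0 * (1 + norm u)" by (simp add: algebra_simps)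
        also have "\<dots> < \<epsilon>" using z0(2) pos by (simp add: pos_less_divide_eq)
        finally have "norm (cnj z0 - u * z0) < \<epsilon>" .
        moreover have "T z - u * z \<noteq> cnj z0 - u * z0" if "z \<in> ball 0 r - D \<inter> ball 0 r" for z
        proof
          assume "T z - u * z = cnj z0 - u * z0"
          then have "cnj z - u * z = cnj z0 - u * z0" using that by (auto simp: T_def)
          then have "z = z0" by (rule inj_cnj_pencil[OF d(2)[OF u]])
          then show False using that z0(1) by auto
        qed
        ultimately show ?thesis by blast
      qed
    qed (use D(1) D0(1) in \<open>auto intro: continuous_intros holomorphic_intros\<close>)
    then obtain \<epsilon> where \<epsilon>: "\<epsilon> > 0" "\<And>z. z \<in> D \<inter> ball 0 r \<Longrightarrow> norm z < \<epsilon> \<Longrightarrow> z \<noteq> 0 \<Longrightarrow> \<epsilon> \<le> dist w (T z / z)"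
      by blast
    show ?thesis
    proof (intro exI[of _ "min \<epsilon> r"] conjI ballI impI)
      fix z assume z: "z \<in> D" "norm z < min \<epsilon> r"
      then have "\<epsilon> \<le> dist w (T z / z)" using D0(1) by (intro \<epsilon>(2)) auto
      then show "min \<epsilon> r \<le> dist w (S z / z)" using z(1) by (simp add: T_def)
    qed (use \<epsilon>(1) r(1) in simp)
  qed
  \<comment> \<open>Exchanging the roles of \<open>T z\<close> and \<open>z\<close> at the value 0
    keeps \<open>S z / z\<close> away from infinity.\<close>
  have bounded: "\<exists>\<epsilon>>0. \<forall>z\<in>D. norm z < \<epsilon> \<longrightarrow> \<epsilon> * norm (S z / z) \<le> 1"
  proof -
    \<comment> \<open>Any radius between 0 and 1 would do, since \<open>z - 0 * T z\<close> has no
      zero on a circle around 0.\<close>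
    define r :: real where "r = 1/2"
    have r: "0 < r" "r < 1" by (simp_all add: r_def)
    have cb: "cball 0 r \<subseteq> ball (0::complex) 1" using r(2) by auto
    have "\<exists>\<epsilon>>0. \<forall>z\<in>D \<inter> ball 0 r. norm z < \<epsilon> \<longrightarrow> T z \<noteq> 0 \<longrightarrow> \<epsilon> \<le> dist 0 (z / T z)"
    proof (rule pencil_quotient_avoids_value[where A = "\<lambda>z. z", OF _ _ _ r(1) zero_less_one])
      show "continuous_on (cball 0 r) T" using contT cb continuous_on_subset by blast
      show "T holomorphic_on D \<inter> ball 0 r" using holT by (rule holomorphic_on_subset) auto
      show "norm z = norm (T z)" if "z \<in> ball 0 r - D \<inter> ball 0 r" for z
        using that by (auto simp: T_def)
      show "z \<noteq> 0 * T z" if "z \<in> sphere 0 r" for z using that r by auto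
      show "\<not> ball 0 \<epsilon> - {0} \<subseteq> D \<inter> ball 0 r" if "\<epsilon> > 0" for \<epsilon>
        using nonisolated[OF that] by blast
      show "\<exists>c. norm c < \<epsilon> \<and> (\<forall>z\<in>ball 0 r - D \<inter> ball 0 r. z - u * T z \<noteq> c)"
        if u: "u \<in> ball 0 1" and \<epsilon>: "\<epsilon> > 0" for u \<epsilon>
      proof -
        have pos: "1 + norm u > 0" by (simp add: add_pos_nonneg)
        obtain z0 where z0: "z0 \<in> D" "norm z0 < \<epsilon> / (1 + norm u)"
          using small_point[of "\<epsilon> / (1 + norm u)"] \<epsilon> pos by auto
        have "norm (z0 - u * cnj z0) \<le> norm z0 + norm u * norm z0"
          using norm_triangle_ineq4[of z0 "u * cnj z0"] by (simp add: norm_mult)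
        also have "\<dots> = norm z0 * (1 + norm u)" by (simp add: algebra_simps)
        also have "\<dots> < \<epsilon>" using z0(2) pos by (simp add: pos_less_divide_eq)
        finally have "norm (z0 - u * cnj z0) < \<epsilon>" .
        moreover have u1: "norm u \<noteq> 1" using u by simp
        have "z - u * T z \<noteq> z0 - u * cnj z0" if "z \<in> ball 0 r - D \<inter> ball 0 r" for z
        proof
          assume "z - u * T z = z0 - u * cnj z0"
          then have "z - u * cnj z = z0 - u * cnj z0" using that by (auto simp: T_def)
          then have "z = z0" by (rule inj_cnj_pencil'[OF u1])
          then show False using that z0(1) by auto
        qed
        ultimately show ?thesis by blast
      qed
    qed (use D(1) D0(1) in \<open>auto intro: continuous_intros holomorphic_intros\<close>)
    then obtain \<epsilon> where \<epsilon>: "\<epsilon> > 0" "\<And>z. z \<in> D \<inter> ball 0 r \<Longrightarrow> norm z < \<epsilon> \<Longrightarrow> T z \<noteq> 0 \<Longrightarrow> \<epsilon> \<le> dist 0 (z / T z)"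
      by blast
    show ?thesis
    proof (intro exI[of _ "min \<epsilon> r"] conjI ballI impI)
      fix z assume z: "z \<in> D" "norm z < min \<epsilon> r"
      show "min \<epsilon> r * norm (S z / z) \<le> 1"
      proof (cases "S z = 0")
        case False
        have "z \<noteq> 0" using z(1) D0(1) by auto
        have "\<epsilon> \<le> dist 0 (z / T z)" using False z by (intro \<epsilon>(2)) (auto simp: T_def)
        then have "\<epsilon> * norm (S z / z) \<le> 1"
          using z(1) False \<open>z \<noteq> 0\<close> by (simp add: T_def norm_divide field_simps)
        moreover have "min \<epsilon> r * norm (S z / z) \<le> \<epsilon> * norm (S z / z)"
          by (intro mult_right_mono) auto
        ultimately show ?thesis by linarith
      qed simp
    qed (use \<epsilon>(1) r(1) in simp)
  qed
  show ?thesis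
  proof (rule tendstoI)
    fix e :: real assume e: "e > 0"
    obtain \<beta> where \<beta>: "\<beta> > 0" "\<And>z. z \<in> D \<Longrightarrow> norm z < \<beta> \<Longrightarrow> \<beta> * norm (S z / z) \<le> 1"
      using bounded by blast
    \<comment> \<open>With infinity excluded, the remaining forbidden values form a compact set. A
      finite cover by balls from \<open>avoid\<close> gives one neighbourhood of 0 that serves all
      of them.\<close>
    define K where "K = cball 0 (1/\<beta>) \<inter> {w::complex. e \<le> \<bar>norm w - 1\<bar>}"
    have "closed {w::complex. e \<le> \<bar>norm w - 1\<bar>}" by (intro closed_Collect_le continuous_intros)
    then have K: "compact K" unfolding K_def by (intro compact_Int_closed compact_cball)
    have "\<exists>\<epsilon>. \<forall>w\<in>K. \<epsilon> w > 0 \<and> (\<forall>z\<in>D. norm z < \<epsilon> w \<longrightarrow> \<epsilon> w \<le> dist w (S z / z))"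
      using e by (intro bchoice ballI avoid) (auto simp: K_def)
    then obtain \<epsilon> where \<epsilon>: "\<And>w. w \<in> K \<Longrightarrow> \<epsilon> w > 0"
        "\<And>w z. w \<in> K \<Longrightarrow> z \<in> D \<Longrightarrow> norm z < \<epsilon> w \<Longrightarrow> \<epsilon> w \<le> dist w (S z / z)"
      by blast
    obtain C where C: "C \<subseteq> K" "finite C" "K \<subseteq> (\<Union>w\<in>C. ball w (\<epsilon> w))"
      by (rule compactE_image[OF K, of K "\<lambda>w. ball w (\<epsilon> w)"]) (use \<epsilon>(1) in auto)
    have "\<forall>\<^sub>F z in at 0 within D. \<forall>w\<in>C. norm z < \<epsilon> w"
    proof (intro eventually_ball_finite C(2) ballI)
      fix w assume "w \<in> C"
      then have "\<epsilon> w > 0" using \<epsilon>(1) C(1) by blast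
      then show "\<forall>\<^sub>F z in at 0 within D. norm z < \<epsilon> w"
        unfolding eventually_at by (intro exI[of _ "\<epsilon> w"]) simp
    qed
    moreover have "\<forall>\<^sub>F z in at 0 within D. z \<in> D \<and> norm z < \<beta>"
      using \<beta>(1) unfolding eventually_at by (intro exI[of _ \<beta>]) simp
    ultimately show "\<forall>\<^sub>F z in at 0 within D. dist (cmod (S z / z)) 1 < e"
    proof eventually_elim
      case (elim z)
      have "S z / z \<notin> K"
      proof
        assume "S z / z \<in> K"
        then obtain w where "w \<in> C" "dist w (S z / z) < \<epsilon> w" using C(3) by auto
        then show False using \<epsilon>(2)[of w z] C(1) elim by fastforce
      qed
      moreover have "S z / z \<in> cball 0 (1/\<beta>)"
        using \<beta>(2)[of z] elim \<beta>(1) by (simp add: field_simps)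
      ultimately show ?case by (auto simp: K_def dist_real_def)
    qed
  qed
qed

end
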